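(* There exists a binary tree-structured sparsity model $\mathbb{M}_{\mathrm{tree}}$ (on a rooted binary tree $T$ with node set $[d]$, with sparsity $s$) such that, in each of the following settings, with $\beta^*$ drawn uniformly at random from a suitable finite set of signals in $\mathbb{R}^d$ with supports in $\mathbb{M}_{\mathrm{tree}}$, and irrespective of the procedure used to infer $\hat\beta$ from $(X,y)$: 1. If $n\in\tilde{o}(s)$ then $\mathbb{P}(\|\beta^*-\hat\beta\|\ge C\|e\|)\ge\frac1{10}$ for noisy standard compressed sensing, for all $0<C\le C_0$, where $C_0>0$ is a constant. 2. If $n\in\tilde{o}(s)$ then $\mathbb{P}(\beta^*\ne\hat\beta)\ge\frac12$ for noiseless standard compressed sensing. 3. If $n\in o(s)$ then $\mathbb{P}\Big(\Big\|\frac{\hat\beta}{\|\hat\beta\|}-\frac{\beta^*}{\|\beta^*\|}\Big\|\ge\epsilon\Big)\ge\frac12$ for one-bit compressed sensing, for some $\epsilon>0$ (not depending on the procedure). 4. If $n\in o(s)$ then $\mathbb{P}(\hat\beta\ne\beta^* )\ge\frac12$ for one-bit compressed sensing.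
   Context: Tree-structured sparsity model. Let $T$ be a rooted binary tree on the node set $[d]=\{1,\dots,d\}$, and let $\pi_T(i)$ denote the parent of node $i$ in $T$ (no condition is imposed at the root). Then $\mathbb{M}_{\mathrm{tree}}=\{S\subseteq[d] : |S|=s,\ \text{and } \pi_T(i)\in S \text{ for all } i\in S\}$, i.e. supports are rooted connected subtrees with $s$ nodes. Observation settings ($n$ i.i.d. observations, $X\in\mathbb{R}^{n\times d}$, with $\beta^*$, $X$, $e$ independent): - Noisy standard compressed sensing: $y=X\beta^*+e$, $X$ has i.i.d. $\mathcal{N}(0,1/n)$ entries, $e$ has i.i.d. $\mathcal{N}(0,\sigma^2)$ entries. - Noiseless standard compressed sensing: $y=X\beta^*$, $X$ has i.i.d. entries equal to $\pm 1/\sqrt n$ with probability $\frac12$ each. - One-bit compressed sensing: $y=\operatorname{sign}(X\beta^*+e)\in\{-1,+1\}^n$ (coordinatewise, any fixed convention at $0$), $X$ has i.i.d. $\mathcal{N}(0,1/n)$ entries, and $e$ either has i.i.d. $\mathcal{N}(0,\sigma^2)$ entries or is $0$. $\|\cdot\|$ is the $\ell_2$-norm. In each setting nature draws $\beta^*$ uniformly at random from a finite set of $s$-sparse signals whose supports lie in the model and whose non-zero entries take values in a particular finite set (which may depend on the setting and on the problem parameters, including $n$ and $\sigma$). A procedure is any (possibly randomized) measurable map from $(X,y)$ to $\hat\beta\in\mathbb{R}^d$ (nonzero in item 3). Asymptotic convention. "A model" is a family of models indexed by $m\in\mathbb{N}$ with $s=s_m\to\infty$; $C_0$ does not depend on $m$,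 while $\epsilon$ may. $\tilde{o}$ hides a factor logarithmic in $s$: $n\in\tilde{o}(s)$ means $n\in o(s/\log s)$. "If $n\in o(\Phi)$ then $P$" means: for every sequence of positive integers $n_m$ with $n_m/\Phi_m\to0$, $P$ holds for all sufficiently large $m$. *)

theory Defs
  imports "HOL-Probability.Probability" "HOL-Library.Landau_Symbols"
begin

text \<open>
  The dimensions vary with the index of the model family, so vectors in \<open>\<real>\<^sup>k\<close> are extensional
  functions on \<open>{1..k}\<close>, \<open>n \<times> d\<close> matrices are extensional functions on \<open>{1..n} \<times> {1..d}\<close>, and the
  Euclidean norm is \<^const>\<open>L2_set\<close> over the index set.
\<close>

definition vec_space :: "nat \<Rightarrow> (nat \<Rightarrow> real) measure" where
  "vec_space k = (\<Pi>\<^sub>M i\<in>{1..k}. borel)"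

definition mat_space :: "nat \<Rightarrow> nat \<Rightarrow> (nat \<times> nat \<Rightarrow> real) measure" where
  "mat_space n d = (\<Pi>\<^sub>M ij\<in>{1..n} \<times> {1..d}. borel)"


subsection \<open>Tree-structured sparsity\<close>

text \<open>
  \<open>r\<close> is the root and \<open>\<pi> i\<close> the parent of a node \<open>i \<noteq> r\<close>; the value \<open>\<pi> r\<close> is irrelevant.
\<close>

definition rooted_binary_tree :: "nat \<Rightarrow> nat \<Rightarrow> (nat \<Rightarrow> nat) \<Rightarrow> bool" where
  "rooted_binary_tree d r \<pi> \<longleftrightarrow>
     r \<in> {1..d} \<and>
     (\<forall>i\<in>{1..d} - {r}. \<pi> i \<in> {1..d}) \<and>
     (\<forall>i\<in>{1..d}. \<exists>k. (\<pi> ^^ k) i = r) \<and>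
     (\<forall>j\<in>{1..d}. card {i \<in> {1..d} - {r}. \<pi> i = j} \<le> 2)"

definition tree_model :: "nat \<Rightarrow> nat \<Rightarrow> (nat \<Rightarrow> nat) \<Rightarrow> nat \<Rightarrow> nat set set" where
  "tree_model d r \<pi> s = {S. S \<subseteq> {1..d} \<and> card S = s \<and> (\<forall>i\<in>S. i \<noteq> r \<longrightarrow> \<pi> i \<in> S)}"

definition support :: "nat \<Rightarrow> (nat \<Rightarrow> real) \<Rightarrow> nat set" where
  "support d \<beta> = {i \<in> {1..d}. \<beta> i \<noteq> 0}"

definition signal_set :: "nat \<Rightarrow> nat set set \<Rightarrow> (nat \<Rightarrow> real) set \<Rightarrow> bool" where
  "signal_set d \<M> B \<longleftrightarrow>
     finite B \<and> B \<noteq> {} \<and>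
     (\<exists>V. finite V \<and>
        B \<subseteq> {\<beta> \<in> {1..d} \<rightarrow>\<^sub>E UNIV. support d \<beta> \<in> \<M> \<and> \<beta> ` support d \<beta> \<subseteq> V})"


subsection \<open>Designs, noise and observations\<close>

definition normal_law :: "real \<Rightarrow> real measure" where
  "normal_law \<sigma> = density lborel (normal_density 0 \<sigma>)"

definition sign_law :: "real \<Rightarrow> real measure" where
  "sign_law a = distr (measure_pmf (pmf_of_set {- a, a})) borel (\<lambda>x. x)"

definition iid_vec :: "nat \<Rightarrow> real measure \<Rightarrow> (nat \<Rightarrow> real) measure" where
  "iid_vec n \<mu> = (\<Pi>\<^sub>M i\<in>{1..n}. \<mu>)"

definition iid_mat :: "nat \<Rightarrow> nat \<Rightarrow> real measure \<Rightarrow> (nat \<times> nat \<Rightarrow> real) measure" where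
  "iid_mat n d \<mu> = (\<Pi>\<^sub>M ij\<in>{1..n} \<times> {1..d}. \<mu>)"

definition gaussian_design :: "nat \<Rightarrow> nat \<Rightarrow> (nat \<times> nat \<Rightarrow> real) measure" where
  "gaussian_design n d = iid_mat n d (normal_law (1 / sqrt (real n)))"

definition sign_design :: "nat \<Rightarrow> nat \<Rightarrow> (nat \<times> nat \<Rightarrow> real) measure" where
  "sign_design n d = iid_mat n d (sign_law (1 / sqrt (real n)))"

definition gaussian_noise :: "nat \<Rightarrow> real \<Rightarrow> (nat \<Rightarrow> real) measure" where
  "gaussian_noise n \<sigma> = iid_vec n (normal_law \<sigma>)"

definition no_noise :: "nat \<Rightarrow> (nat \<Rightarrow> real) measure" where
  "no_noise n = return (vec_space n) (\<lambda>i\<in>{1..n}. 0)"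

type_synonym obs_map = "(nat \<times> nat \<Rightarrow> real) \<Rightarrow> (nat \<Rightarrow> real) \<Rightarrow> (nat \<Rightarrow> real) \<Rightarrow> nat \<Rightarrow> real"

definition mat_vec :: "nat \<Rightarrow> nat \<Rightarrow> (nat \<times> nat \<Rightarrow> real) \<Rightarrow> (nat \<Rightarrow> real) \<Rightarrow> nat \<Rightarrow> real" where
  "mat_vec n d X \<beta> = (\<lambda>i\<in>{1..n}. \<Sum>j\<in>{1..d}. X (i, j) * \<beta> j)"

definition noisy_obs :: "nat \<Rightarrow> nat \<Rightarrow> obs_map" where
  "noisy_obs n d X \<beta> e = (\<lambda>i\<in>{1..n}. mat_vec n d X \<beta> i + e i)"

definition noiseless_obs :: "nat \<Rightarrow> nat \<Rightarrow> obs_map" where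
  "noiseless_obs n d X \<beta> e = mat_vec n d X \<beta>"

text \<open>The parameter \<open>z \<in> {-1, 1}\<close> is the value of the sign function at \<open>0\<close>.\<close>

definition sign_at0 :: "real \<Rightarrow> real \<Rightarrow> real" where
  "sign_at0 z t = (if t = 0 then z else sgn t)"

definition one_bit_obs :: "real \<Rightarrow> nat \<Rightarrow> nat \<Rightarrow> obs_map" where
  "one_bit_obs z n d X \<beta> e = (\<lambda>i\<in>{1..n}. sign_at0 z (mat_vec n d X \<beta> i + e i))"


subsection \<open>Inference procedures and the joint law\<close>

text \<open>
  A randomized procedure is a Markov kernel: \<open>K (X, y)\<close> is the law of the estimate given the data.
  Deterministic measurable maps are the kernels with point-mass values.
\<close>

definition procedures ::
  "nat \<Rightarrow> nat \<Rightarrow> ((nat \<times> nat \<Rightarrow> real) \<times> (nat \<Rightarrow> real) \<Rightarrow> (nat \<Rightarrow> real) measure) set" where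
  "procedures n d =
     measurable (mat_space n d \<Otimes>\<^sub>M vec_space n) (prob_algebra (vec_space d))"

definition nonzero_procedures ::
  "nat \<Rightarrow> nat \<Rightarrow> ((nat \<times> nat \<Rightarrow> real) \<times> (nat \<Rightarrow> real) \<Rightarrow> (nat \<Rightarrow> real) measure) set" where
  "nonzero_procedures n d =
     {K \<in> procedures n d. \<forall>x \<in> space (mat_space n d \<Otimes>\<^sub>M vec_space n). AE b in K x. support d b \<noteq> {}}"

text \<open>
  Joint law of \<open>(\<beta>, X, e, b)\<close>: \<open>\<beta>\<close> is uniform on \<open>B\<close>, \<open>X \<sim> P\<^sub>X\<close> and \<open>e \<sim> P\<^sub>e\<close>, all independent, and
  \<open>b\<close> is the estimate drawn from \<open>K (X, y)\<close> with \<open>y = obs X \<beta> e\<close>.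
\<close>

definition joint_law ::
  "nat \<Rightarrow> (nat \<Rightarrow> real) set \<Rightarrow> (nat \<times> nat \<Rightarrow> real) measure \<Rightarrow> (nat \<Rightarrow> real) measure \<Rightarrow> obs_map \<Rightarrow>
   ((nat \<times> nat \<Rightarrow> real) \<times> (nat \<Rightarrow> real) \<Rightarrow> (nat \<Rightarrow> real) measure) \<Rightarrow>
   ((nat \<Rightarrow> real) \<times> (nat \<times> nat \<Rightarrow> real) \<times> (nat \<Rightarrow> real) \<times> (nat \<Rightarrow> real)) measure" where
  "joint_law d B P\<^sub>X P\<^sub>e obs K =
     (uniform_count_measure B \<Otimes>\<^sub>M P\<^sub>X \<Otimes>\<^sub>M P\<^sub>e) \<bind> (\<lambda>(\<beta>, X, e).
       K (X, obs X \<beta> e) \<bind> (\<lambda>b.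
         return (uniform_count_measure B \<Otimes>\<^sub>M P\<^sub>X \<Otimes>\<^sub>M P\<^sub>e \<Otimes>\<^sub>M vec_space d) (\<beta>, X, e, b)))"

end

(*
  The tree is a comb: a spine of 2k nodes, each with one leaf attached. A support consists of the spine
  and k of the 2k leaves, which gives at least 2^k supports of size s = 3k, and the signals are a
  multiple of the indicator of such a support. Given (X, e), summing the probability of success over
  all signals: an estimate can be correct for at most one signal, so if the observation takes at most
  N values then the success probability is at most N / 2^k. This settles the noiseless case with
  N = (8k + 1)^n and the one-bit case with N = 2^n.

  With Gaussian noise the observation is not discrete. Instead, outside an event of small probability
  the laws of X \<beta> + e, for all \<beta> at once, are dominated by L^n times one and the same Gaussian law with
  a larger variance, and L is polynomial in s. The same summation then bounds the success probability
  by L^n / 2^k. Since L may be polynomial in s, the amplitude of the signals can be taken so large that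
  two of them differ by more than twice the typical norm of the noise in a single coordinate.
*)
theory Submission
  imports Defs
begin

subsection \<open>Success probabilities under the joint law\<close>

text \<open>The settings of all four claims are instances. Measurability of \<open>obs\<close> is
  asked in (X, e) for each fixed \<open>\<beta>\<close> only; finiteness of \<open>B\<close> turns
  this into joint measurability with \<open>\<beta>\<close>.\<close>

locale inference_model =
  fixes n d :: nat
    and B :: "(nat \<Rightarrow> real) set"
    and P\<^sub>X :: "(nat \<times> nat \<Rightarrow> real) measure"
    and P\<^sub>e :: "(nat \<Rightarrow> real) measure"
    and obs :: obs_map
    and K :: "(nat \<times> nat \<Rightarrow> real) \<times> (nat \<Rightarrow> real) \<Rightarrow> (nat \<Rightarrow> real) measure"
  assumes finite_B: "finite B" and B_nonempty: "B \<noteq> {}"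
    and prob_design: "prob_space P\<^sub>X" and sets_design [measurable_cong]: "sets P\<^sub>X = sets (mat_space n d)"
    and prob_noise: "prob_space P\<^sub>e" and sets_noise [measurable_cong]: "sets P\<^sub>e = sets (vec_space n)"
    and obs_measurable [measurable]:
      "\<And>\<beta>. (\<lambda>(X, e). obs X \<beta> e) \<in> mat_space n d \<Otimes>\<^sub>M vec_space n \<rightarrow>\<^sub>M vec_space n"
    and procedure: "K \<in> procedures n d"
begin

abbreviation "\<U> \<equiv> uniform_count_measure B"
abbreviation "\<S> \<equiv> \<U> \<Otimes>\<^sub>M P\<^sub>X \<Otimes>\<^sub>M P\<^sub>e \<Otimes>\<^sub>M vec_space d"
abbreviation "\<J> \<equiv> joint_law d B P\<^sub>X P\<^sub>e obs K"

lemma prob_data: "prob_space (P\<^sub>X \<Otimes>\<^sub>M P\<^sub>e)"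
  by (intro prob_space_pair prob_design prob_noise)

lemma prob_U: "prob_space \<U>"
  using finite_B B_nonempty by (rule prob_space_uniform_count_measure)

lemma K_measurable [measurable]: "K \<in> P\<^sub>X \<Otimes>\<^sub>M vec_space n \<rightarrow>\<^sub>M prob_algebra (vec_space d)"
  using procedure unfolding procedures_def by measurable

lemma obs_measurable' [measurable]: "(\<lambda>(X, e). obs X \<beta> e) \<in> P\<^sub>X \<Otimes>\<^sub>M P\<^sub>e \<rightarrow>\<^sub>M vec_space n"
  using obs_measurable by measurable

lemma estimate_measurable [measurable]:
  "(\<lambda>(X, e). K (X, obs X \<beta> e)) \<in> P\<^sub>X \<Otimes>\<^sub>M P\<^sub>e \<rightarrow>\<^sub>M prob_algebra (vec_space d)"
  using obs_measurable'[of \<beta>] by measurable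

lemma estimate_prob_space:
  assumes "X \<in> space P\<^sub>X" "e \<in> space P\<^sub>e"
  shows "prob_space (K (X, obs X \<beta> e))" "sets (K (X, obs X \<beta> e)) = sets (vec_space d)"
  using measurable_space[OF estimate_measurable, of "(X, e)"] assms
  by (auto simp: space_pair_measure space_prob_algebra)

text \<open>Gives the bind in \<open>joint_law\<close> its meaning. The prior carries the discrete
  sigma-algebra of the finite set \<open>B\<close>, so it suffices to treat the sections at fixed
  \<open>\<beta>\<close>.\<close>

lemma kernel_measurable:
  "(\<lambda>(\<beta>, X, e). K (X, obs X \<beta> e) \<bind> (\<lambda>b. return \<S> (\<beta>, X, e, b))) \<in> \<U> \<Otimes>\<^sub>M P\<^sub>X \<Otimes>\<^sub>M P\<^sub>e \<rightarrow>\<^sub>M prob_algebra \<S>"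
proof -
  have "(\<lambda>(\<beta>, X, e). K (X, obs X \<beta> e) \<bind> (\<lambda>b. return \<S> (\<beta>, X, e, b)))
      \<in> count_space B \<Otimes>\<^sub>M (P\<^sub>X \<Otimes>\<^sub>M P\<^sub>e) \<rightarrow>\<^sub>M prob_algebra \<S>"
  proof (rule measurable_pair_measure_countable1)
    fix \<beta> assume "\<beta> \<in> B"
    then have [measurable]: "\<beta> \<in> space \<U>"
      by (simp add: space_uniform_count_measure)
    have "(\<lambda>x. K (fst x, obs (fst x) \<beta> (snd x)) \<bind> (\<lambda>b. return \<S> (\<beta>, fst x, snd x, b)))
        \<in> P\<^sub>X \<Otimes>\<^sub>M P\<^sub>e \<rightarrow>\<^sub>M prob_algebra \<S>"
    proof (rule measurable_bind_prob_space2)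
      show "(\<lambda>x. K (fst x, obs (fst x) \<beta> (snd x))) \<in> P\<^sub>X \<Otimes>\<^sub>M P\<^sub>e \<rightarrow>\<^sub>M prob_algebra (vec_space d)"
        using estimate_measurable[of \<beta>] by (simp add: case_prod_beta)
    qed measurable
    then show "(\<lambda>y. case (\<beta>, y) of (\<beta>, X, e) \<Rightarrow> K (X, obs X \<beta> e) \<bind> (\<lambda>b. return \<S> (\<beta>, X, e, b)))
        \<in> P\<^sub>X \<Otimes>\<^sub>M P\<^sub>e \<rightarrow>\<^sub>M prob_algebra \<S>"
      by (simp add: case_prod_beta)
  qed (simp add: finite_B countable_finite)
  then show ?thesis
    by (simp cong: measurable_cong_sets add: sets_uniform_count_measure_count_space)
qed

lemma prior_prob: "\<U> \<Otimes>\<^sub>M P\<^sub>X \<Otimes>\<^sub>M P\<^sub>e \<in> space (prob_algebra (\<U> \<Otimes>\<^sub>M P\<^sub>X \<Otimes>\<^sub>M P\<^sub>e))"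
  by (simp add: space_prob_algebra prob_space_pair prob_U prob_data)

lemma prob_joint_law: "prob_space \<J>"
  unfolding joint_law_def by (rule prob_space_bind'[OF prior_prob kernel_measurable])

lemma sets_joint_law: "sets \<J> = sets \<S>"
  unfolding joint_law_def by (rule sets_bind'[OF prior_prob kernel_measurable])

lemma sets_S: "sets \<S> = sets (count_space B \<Otimes>\<^sub>M (mat_space n d \<Otimes>\<^sub>M vec_space n \<Otimes>\<^sub>M vec_space d))"
  by (intro sets_pair_measure_cong refl sets_design sets_noise sets_uniform_count_measure_count_space)

lemma joint_event_sets:
  assumes "\<And>\<beta>. \<beta> \<in> B \<Longrightarrow>
    Measurable.pred (mat_space n d \<Otimes>\<^sub>M vec_space n \<Otimes>\<^sub>M vec_space d) (\<lambda>(X, e, b). Q \<beta> X e b)"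
  shows "{\<omega> \<in> space \<J>. case \<omega> of (\<beta>, X, e, b) \<Rightarrow> Q \<beta> X e b} \<in> sets \<J>"
proof -
  have "Measurable.pred (count_space B \<Otimes>\<^sub>M (mat_space n d \<Otimes>\<^sub>M vec_space n \<Otimes>\<^sub>M vec_space d))
      (\<lambda>(\<beta>, X, e, b). Q \<beta> X e b)"
    by (rule measurable_pair_measure_countable1) (use finite_B assms in \<open>simp_all add: countable_finite\<close>)
  then show ?thesis
    unfolding sets_joint_law sets_eq_imp_space_eq[OF sets_joint_law]
      sets_S sets_eq_imp_space_eq[OF sets_S] by (simp only: pred_def)
qed

text \<open>The prior is integrated innermost, so that for fixed (X, e) the sum over all signals
  stands under the integral; the counting arguments bound exactly this sum.\<close>

lemma emeasure_joint_law:
  assumes Q: "\<And>\<beta>. \<beta> \<in> B \<Longrightarrow>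
    Measurable.pred (mat_space n d \<Otimes>\<^sub>M vec_space n \<Otimes>\<^sub>M vec_space d) (\<lambda>(X, e, b). Q \<beta> X e b)"
  shows "emeasure \<J> {\<omega> \<in> space \<J>. case \<omega> of (\<beta>, X, e, b) \<Rightarrow> Q \<beta> X e b} =
    (\<integral>\<^sup>+(X, e). ennreal (1 / card B) *
       (\<Sum>\<beta>\<in>B. emeasure (K (X, obs X \<beta> e)) {b \<in> space (vec_space d). Q \<beta> X e b}) \<partial>(P\<^sub>X \<Otimes>\<^sub>M P\<^sub>e))"
proof -
  define G where "G = {\<omega> \<in> space \<J>. case \<omega> of (\<beta>, X, e, b) \<Rightarrow> Q \<beta> X e b}"
  define F where "F = (\<lambda>(\<beta>, X, e). K (X, obs X \<beta> e) \<bind> (\<lambda>b. return \<S> (\<beta>, X, e, b)))"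
  have G: "G \<in> sets \<S>"
    using joint_event_sets[OF Q] unfolding G_def sets_joint_law by simp
  have F [measurable]: "F \<in> \<U> \<Otimes>\<^sub>M P\<^sub>X \<Otimes>\<^sub>M P\<^sub>e \<rightarrow>\<^sub>M prob_algebra \<S>"
    unfolding F_def by (rule kernel_measurable)
  interpret U: prob_space \<U> by (rule prob_U)
  interpret D: prob_space "P\<^sub>X \<Otimes>\<^sub>M P\<^sub>e" by (rule prob_data)
  interpret UD: pair_sigma_finite \<U> "P\<^sub>X \<Otimes>\<^sub>M P\<^sub>e" by standard
  have FG: "emeasure (F (\<beta>, X, e)) G = emeasure (K (X, obs X \<beta> e)) {b \<in> space (vec_space d). Q \<beta> X e b}"
    if "\<beta> \<in> B" "X \<in> space P\<^sub>X" "e \<in> space P\<^sub>e" for \<beta> X e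
  proof -
    note Kp = estimate_prob_space[OF that(2,3), of \<beta>]
    have sp: "space (K (X, obs X \<beta> e)) = space (vec_space d)"
      using Kp(2) by (rule sets_eq_imp_space_eq)
    have m: "(\<lambda>b. (\<beta>, X, e, b)) \<in> K (X, obs X \<beta> e) \<rightarrow>\<^sub>M \<S>"
      unfolding measurable_cong_sets[OF Kp(2) refl]
      using that by (intro measurable_Pair) (auto simp: space_uniform_count_measure)
    \<comment> \<open>Adjoining the estimate to a fixed triple is a pushforward, so the mass of
      \<open>G\<close> is the mass of its section at (\<beta>, X, e).\<close>
    have "F (\<beta>, X, e) = distr (K (X, obs X \<beta> e)) \<S> (\<lambda>b. (\<beta>, X, e, b))"
      unfolding F_def by (simp add: bind_return_distr'[OF prob_space.not_empty[OF Kp(1)] m])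
    then have "emeasure (F (\<beta>, X, e)) G = emeasure (K (X, obs X \<beta> e)) ((\<lambda>b. (\<beta>, X, e, b)) -` G \<inter> space (vec_space d))"
      using emeasure_distr[OF m G] by (simp add: sp)
    also have "(\<lambda>b. (\<beta>, X, e, b)) -` G \<inter> space (vec_space d) = {b \<in> space (vec_space d). Q \<beta> X e b}"
      using that by (auto simp: G_def sets_eq_imp_space_eq[OF sets_joint_law] space_pair_measure space_uniform_count_measure)
    finally show ?thesis .
  qed
  have "emeasure \<J> G = (\<integral>\<^sup>+x. emeasure (F x) G \<partial>(\<U> \<Otimes>\<^sub>M P\<^sub>X \<Otimes>\<^sub>M P\<^sub>e))"
    unfolding joint_law_def F_def[symmetric] by (rule emeasure_bind_prob_algebra[OF prior_prob F G])
  also have "\<dots> = (\<integral>\<^sup>+x. (\<integral>\<^sup>+\<beta>. emeasure (F (\<beta>, x)) G \<partial>\<U>) \<partial>(P\<^sub>X \<Otimes>\<^sub>M P\<^sub>e))"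
    by (rule UD.nn_integral_snd[symmetric])
      (rule measurable_emeasure_kernel[OF measurable_prob_algebraD[OF F] G])
  also have "\<dots> = (\<integral>\<^sup>+(X, e). ennreal (1 / card B) *
       (\<Sum>\<beta>\<in>B. emeasure (K (X, obs X \<beta> e)) {b \<in> space (vec_space d). Q \<beta> X e b}) \<partial>(P\<^sub>X \<Otimes>\<^sub>M P\<^sub>e))"
    by (rule nn_integral_cong)
      (auto simp: uniform_count_measure_def nn_integral_point_measure_finite finite_B sum_distrib_left
         space_pair_measure FG intro!: sum.cong)
  finally show ?thesis
    unfolding G_def .
qed

text \<open>The notation \<open>\<P>\<close> with a tuple pattern unfolds to the left-hand form,
  while measurability and mass of events are available for the right-hand form.\<close>

lemma Collect_quadruple_eq:
  "{(\<beta>, X, e, b). (\<beta>, X, e, b) \<in> S \<and> Q \<beta> X e b} = {\<omega> \<in> S. case \<omega> of (\<beta>, X, e, b) \<Rightarrow> Q \<beta> X e b}"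
  by auto

text \<open>Passage to the complement: \<open>\<not> Q\<close> is the success of the estimate, and
  \<open>c\<close> bounds its probability averaged over the uniform prior.\<close>

lemma prob_joint_law_ge:
  assumes Q: "\<And>\<beta>. \<beta> \<in> B \<Longrightarrow>
      Measurable.pred (mat_space n d \<Otimes>\<^sub>M vec_space n \<Otimes>\<^sub>M vec_space d) (\<lambda>(X, e, b). Q \<beta> X e b)"
    and bound: "(\<integral>\<^sup>+(X, e). ennreal (1 / card B) *
       (\<Sum>\<beta>\<in>B. emeasure (K (X, obs X \<beta> e)) {b \<in> space (vec_space d). \<not> Q \<beta> X e b}) \<partial>(P\<^sub>X \<Otimes>\<^sub>M P\<^sub>e)) \<le> ennreal c"
    and c: "0 \<le> c"
  shows "\<P>((\<beta>, X, e, b) in \<J>. Q \<beta> X e b) \<ge> 1 - c"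
proof -
  interpret J: prob_space \<J> by (rule prob_joint_law)
  have Q': "Measurable.pred (mat_space n d \<Otimes>\<^sub>M vec_space n \<Otimes>\<^sub>M vec_space d) (\<lambda>(X, e, b). \<not> Q \<beta> X e b)"
    if "\<beta> \<in> B" for \<beta>
    using pred_intros_logic(2)[OF Q[OF that]] by (simp add: case_prod_beta)
  have "emeasure \<J> {\<omega> \<in> space \<J>. case \<omega> of (\<beta>, X, e, b) \<Rightarrow> \<not> Q \<beta> X e b} \<le> ennreal c"
    by (subst emeasure_joint_law[OF Q']) (use bound in auto)
  then have "\<P>((\<beta>, X, e, b) in \<J>. \<not> Q \<beta> X e b) \<le> c"
    using c by (simp only: J.emeasure_eq_measure ennreal_le_iff Collect_quadruple_eq)
  moreover have "\<P>((\<beta>, X, e, b) in \<J>. \<not> Q \<beta> X e b) = 1 - \<P>((\<beta>, X, e, b) in \<J>. Q \<beta> X e b)"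
    using J.prob_neg[of "\<lambda>(\<beta>, X, e, b). Q \<beta> X e b"] joint_event_sets[OF Q]
    unfolding Collect_quadruple_eq by (simp add: case_prod_beta)
  ultimately show ?thesis by linarith
qed

text \<open>One observation \<open>y\<close> gives one law \<open>K (X, y)\<close>, whatever the
  signal was, and its mass is shared by the disjoint success sets. For randomized procedures this
  expresses that an estimate is correct for at most one signal.\<close>

lemma sum_estimate_le:
  assumes "X \<in> space P\<^sub>X" "y \<in> space (vec_space n)"
    and D: "\<And>\<beta>. \<beta> \<in> B \<Longrightarrow> D \<beta> \<in> sets (vec_space d)" "disjoint_family_on D B"
  shows "(\<Sum>\<beta>\<in>B. emeasure (K (X, y)) (D \<beta>)) \<le> 1"
proof -
  have K: "prob_space (K (X, y))" "sets (K (X, y)) = sets (vec_space d)"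
    using measurable_space[OF K_measurable, of "(X, y)"] assms(1,2)
    by (auto simp: space_pair_measure space_prob_algebra)
  interpret prob_space "K (X, y)" by (rule K)
  have "(\<Sum>\<beta>\<in>B. emeasure (K (X, y)) (D \<beta>)) = emeasure (K (X, y)) (\<Union>\<beta>\<in>B. D \<beta>)"
    using D K(2) finite_B by (intro sum_emeasure) auto
  also have "\<dots> \<le> 1"
    using emeasure_space[of "K (X, y)"] by (simp only: emeasure_space_1)
  finally show ?thesis .
qed

text \<open>For fixed (X, e) at most \<open>N\<close> laws \<open>K (X, y)\<close> occur, and each
  contributes at most 1 to the success probabilities summed over \<open>B\<close>, so their average
  is at most \<open>N / card B\<close>. The bound \<open>few\<close> is almost sure only, because a
  design with random signs may leave its finite set of values on a null set.\<close>

lemma prob_ge_half_if_few_observations: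
  assumes few: "AE (X, e) in P\<^sub>X \<Otimes>\<^sub>M P\<^sub>e. card ((\<lambda>\<beta>. obs X \<beta> e) ` B) \<le> N"
    and Q [measurable]: "\<And>\<beta>. \<beta> \<in> B \<Longrightarrow> Measurable.pred (vec_space d) (Q \<beta>)"
    and disj: "\<And>\<beta> \<beta>' b. \<beta> \<in> B \<Longrightarrow> \<beta>' \<in> B \<Longrightarrow> \<not> Q \<beta> b \<Longrightarrow> \<not> Q \<beta>' b \<Longrightarrow> \<beta> = \<beta>'"
    and card_B: "2 * N \<le> card B"
  shows "\<P>((\<beta>, X, e, b) in \<J>. Q \<beta> b) \<ge> 1 / 2"
proof -
  have Q': "Measurable.pred (mat_space n d \<Otimes>\<^sub>M vec_space n \<Otimes>\<^sub>M vec_space d) (\<lambda>(X, e, b). Q \<beta> b)"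
    if [simp]: "\<beta> \<in> B" for \<beta>
    unfolding case_prod_beta by measurable
  define D where "D \<beta> = {b \<in> space (vec_space d). \<not> Q \<beta> b}" for \<beta>
  have D: "D \<beta> \<in> sets (vec_space d)" if "\<beta> \<in> B" for \<beta>
    using that unfolding D_def by measurable
  have disj_D: "disjoint_family_on D B"
    using disj by (auto simp: disjoint_family_on_def D_def)
  have cpos: "0 < card B"
    using finite_B B_nonempty by (simp add: card_gt_0_iff)
  have le: "ennreal (1 / card B) * (\<Sum>\<beta>\<in>B. emeasure (K (X, obs X \<beta> e)) (D \<beta>)) \<le> ennreal (1 / 2)"
    if "X \<in> space P\<^sub>X" "e \<in> space P\<^sub>e" and N: "card ((\<lambda>\<beta>. obs X \<beta> e) ` B) \<le> N" for X e
  proof -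
    let ?Y = "(\<lambda>\<beta>. obs X \<beta> e) ` B"
    have Y: "y \<in> space (vec_space n)" if "y \<in> ?Y" for y
      using that \<open>X \<in> _\<close> \<open>e \<in> _\<close> measurable_space[OF obs_measurable', of "(X, e)"] by (auto simp: space_pair_measure)
    \<comment> \<open>Enlarging the term of each \<open>\<beta>\<close> to a sum over all attainable
      \<open>y\<close> decouples the observation from the signal, so that the two sums can be
      exchanged.\<close>
    have "(\<Sum>\<beta>\<in>B. emeasure (K (X, obs X \<beta> e)) (D \<beta>)) \<le> (\<Sum>\<beta>\<in>B. \<Sum>y\<in>?Y. emeasure (K (X, y)) (D \<beta>))"
      by (intro sum_mono member_le_sum[where f = "\<lambda>y. emeasure (K (X, y)) _"]) (auto simp: finite_B)
    also have "\<dots> = (\<Sum>y\<in>?Y. \<Sum>\<beta>\<in>B. emeasure (K (X, y)) (D \<beta>))"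
      by (rule sum.swap)
    also have "\<dots> \<le> (\<Sum>y\<in>?Y. 1)"
      by (intro sum_mono sum_estimate_le that D disj_D Y)
    also have "\<dots> \<le> ennreal N"
      using N by (simp add: ennreal_of_nat_eq_real_of_nat)
    finally have "ennreal (1 / card B) * (\<Sum>\<beta>\<in>B. emeasure (K (X, obs X \<beta> e)) (D \<beta>)) \<le> ennreal (1 / card B) * ennreal N"
      by (rule mult_left_mono) simp
    also have "\<dots> = ennreal (1 / card B * N)"
      by (subst ennreal_mult) auto
    also have "\<dots> \<le> ennreal (1 / 2)"
      using card_B cpos by (intro ennreal_leI) (simp add: field_simps)
    finally show ?thesis .
  qed
  have "(\<integral>\<^sup>+(X, e). ennreal (1 / card B) * (\<Sum>\<beta>\<in>B. emeasure (K (X, obs X \<beta> e)) (D \<beta>)) \<partial>(P\<^sub>X \<Otimes>\<^sub>M P\<^sub>e))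
      \<le> (\<integral>\<^sup>+_. ennreal (1 / 2) \<partial>(P\<^sub>X \<Otimes>\<^sub>M P\<^sub>e))"
    using few AE_space by (intro nn_integral_mono_AE, eventually_elim) (use le in \<open>auto simp: space_pair_measure\<close>)
  also have "\<dots> = ennreal (1 / 2)"
    by (simp add: prob_space.emeasure_space_1[OF prob_data])
  finally have "1 - 1 / 2 \<le> \<P>((\<beta>, X, e, b) in \<J>. Q \<beta> b)"
    unfolding D_def by (intro prob_joint_law_ge Q') auto
  then show ?thesis by simp
qed

end

subsection \<open>Domination of shifted Gaussian laws\<close>

lemma sets_normal_law [simp, measurable_cong]: "sets (normal_law \<sigma>) = sets borel"
  by (simp add: normal_law_def)

lemma space_normal_law [simp]: "space (normal_law \<sigma>) = UNIV"
  by (simp add: normal_law_def)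

lemma prob_space_normal_law: "0 < \<sigma> \<Longrightarrow> prob_space (normal_law \<sigma>)"
  unfolding normal_law_def by (rule prob_space_normal_density)

lemma nn_integral_normal_law_square:
  assumes "0 < \<sigma>"
  shows "(\<integral>\<^sup>+x. ennreal (x\<^sup>2) \<partial>normal_law \<sigma>) = ennreal (\<sigma>\<^sup>2)"
proof -
  have "has_bochner_integral lborel (\<lambda>x. normal_density 0 \<sigma> x * x\<^sup>2) (\<sigma>\<^sup>2)"
    using normal_moment_even[OF assms, of 0 1] assms by (simp add: power_divide)
  then have "(\<integral>\<^sup>+x. ennreal (normal_density 0 \<sigma> x * x\<^sup>2) \<partial>lborel) = ennreal (\<sigma>\<^sup>2)"
    by (intro nn_integral_eq_integral[THEN trans])
      (auto simp: has_bochner_integral_iff normal_density_nonneg)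
  then show ?thesis
    by (simp add: normal_law_def nn_integral_density ennreal_mult' normal_density_nonneg)
qed

text \<open>Markov's inequality, as the sum of squares has mean
  \<open>card I * \<sigma>\<^sup>2\<close>. It serves both the noise and the Frobenius norm of the
  design.\<close>

lemma emeasure_sum_squares_normal_le:
  fixes \<sigma> c :: real
  assumes I: "finite I" and \<sigma>: "0 < \<sigma>" and c: "0 < c"
  shows "emeasure (\<Pi>\<^sub>M i\<in>I. normal_law \<sigma>) {x \<in> space (\<Pi>\<^sub>M i\<in>I. normal_law \<sigma>). c * card I * \<sigma>\<^sup>2 < (\<Sum>i\<in>I. (x i)\<^sup>2)}
    \<le> ennreal (1 / c)"
\<comment> \<open>For empty \<open>I\<close> the threshold is 0 and Markov's inequality cannot
  divide by it; strictness makes the event empty.\<close>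
proof (cases "I = {}")
  case True
  then show ?thesis by simp
next
  case False
  let ?M = "\<Pi>\<^sub>M i\<in>I. normal_law \<sigma>"
  define t where "t = c * card I * \<sigma>\<^sup>2"
  have t: "0 < t"
    using False I \<sigma> c by (simp add: t_def card_gt_0_iff)
  have "(\<integral>\<^sup>+x. ennreal (\<Sum>i\<in>I. (x i)\<^sup>2) \<partial>?M) = (\<Sum>i\<in>I. \<integral>\<^sup>+x. ennreal ((x i)\<^sup>2) \<partial>?M)"
    by (simp add: sum_ennreal[symmetric] nn_integral_sum del: sum_ennreal)
  also have "\<dots> = (\<Sum>i\<in>I. \<integral>\<^sup>+y. ennreal (y\<^sup>2) \<partial>distr ?M (normal_law \<sigma>) (\<lambda>x. x i))"
    by (intro sum.cong refl) (simp add: nn_integral_distr)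
  also have "\<dots> = (\<Sum>i\<in>I. \<integral>\<^sup>+y. ennreal (y\<^sup>2) \<partial>normal_law \<sigma>)"
    using prob_space_normal_law[OF \<sigma>] by (intro sum.cong refl) (simp add: distr_PiM_component[where M = "\<lambda>_. normal_law \<sigma>"])
  also have "\<dots> = ennreal (card I * \<sigma>\<^sup>2)"
    by (simp add: nn_integral_normal_law_square[OF \<sigma>] ennreal_of_nat_eq_real_of_nat ennreal_mult)
  finally have *: "(\<integral>\<^sup>+x. ennreal (\<Sum>i\<in>I. (x i)\<^sup>2) \<partial>?M) = ennreal (card I * \<sigma>\<^sup>2)" .
  have "emeasure ?M {x \<in> space ?M. t < (\<Sum>i\<in>I. (x i)\<^sup>2)}
      \<le> emeasure ?M {x \<in> space ?M. 1 \<le> ennreal (1 / t) * ennreal (\<Sum>i\<in>I. (x i)\<^sup>2)}"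
  proof (rule emeasure_mono)
    have "1 \<le> ennreal (1 / t) * ennreal r" if "t < r" for r
      using that t by (simp add: ennreal_mult[symmetric] field_simps flip: ennreal_1)
    then show "{x \<in> space ?M. t < (\<Sum>i\<in>I. (x i)\<^sup>2)}
        \<subseteq> {x \<in> space ?M. 1 \<le> ennreal (1 / t) * ennreal (\<Sum>i\<in>I. (x i)\<^sup>2)}"
      by blast
  qed measurable
  also have "\<dots> \<le> ennreal (1 / t) * (\<integral>\<^sup>+x. ennreal (\<Sum>i\<in>I. (x i)\<^sup>2) * indicator (space ?M) x \<partial>?M)"
    by (intro nn_integral_Markov_inequality) auto
  also have "(\<integral>\<^sup>+x. ennreal (\<Sum>i\<in>I. (x i)\<^sup>2) * indicator (space ?M) x \<partial>?M) = ennreal (card I * \<sigma>\<^sup>2)"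
    unfolding *[symmetric] by (intro nn_integral_cong) (simp add: indicator_def)
  also have "ennreal (1 / t) * ennreal (card I * \<sigma>\<^sup>2) = ennreal (1 / c)"
    using t c \<sigma> False I by (simp add: ennreal_mult[symmetric] t_def)
  finally show ?thesis
    unfolding t_def .
qed

text \<open>Enlarging the variance by \<open>q\<^sup>2\<close> absorbs all shifts of size at most
  \<open>q\<close> at once: \<open>\<tau> / \<sigma>\<close> is the ratio of the normalizing
  constants, and \<open>exp (1 / 2)\<close> is the loss in the exponents.\<close>

lemma normal_density_translate_le:
  assumes \<sigma>: "0 < \<sigma>" and v: "\<bar>v\<bar> \<le> q" and \<tau>: "\<tau> = sqrt (\<sigma>\<^sup>2 + q\<^sup>2)"
  shows "normal_density 0 \<sigma> (y - v) \<le> \<tau> / \<sigma> * exp (1 / 2) * normal_density 0 \<tau> y"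
proof -
  have \<tau>2: "\<tau>\<^sup>2 = \<sigma>\<^sup>2 + q\<^sup>2"
    unfolding \<tau> by simp
  have \<tau>0: "0 < \<tau>"
    unfolding \<tau> using \<sigma> by (simp add: add_pos_nonneg)
  have v2: "\<sigma>\<^sup>2 + v\<^sup>2 \<le> \<tau>\<^sup>2"
    using v unfolding \<tau>2 by (simp add: abs_le_square_iff[symmetric])
  \<comment> \<open>Cauchy-Schwarz for the vectors (v, \<sigma>) and (\<sigma>, y - v), with its
    defect written as a square.\<close>
  have "(\<sigma>\<^sup>2 + v\<^sup>2) * (\<sigma>\<^sup>2 + (y - v)\<^sup>2) - \<sigma>\<^sup>2 * y\<^sup>2 = (\<sigma>\<^sup>2 - (y - v) * v)\<^sup>2"
    by (simp add: power2_eq_square algebra_simps)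
  then have "\<sigma>\<^sup>2 * y\<^sup>2 \<le> (\<sigma>\<^sup>2 + v\<^sup>2) * (\<sigma>\<^sup>2 + (y - v)\<^sup>2)"
    by (metis diff_ge_0_iff_ge zero_le_power2)
  also have "\<dots> \<le> \<tau>\<^sup>2 * (\<sigma>\<^sup>2 + (y - v)\<^sup>2)"
    using v2 by (intro mult_right_mono) auto
  finally have "y\<^sup>2 / (2 * \<tau>\<^sup>2) \<le> 1 / 2 + (y - v)\<^sup>2 / (2 * \<sigma>\<^sup>2)"
    using \<sigma> \<tau>0 by (simp add: divide_simps) (simp add: algebra_simps)
  then have "exp (- (y - v)\<^sup>2 / (2 * \<sigma>\<^sup>2)) \<le> exp (1 / 2) * exp (- y\<^sup>2 / (2 * \<tau>\<^sup>2))"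
    by (simp add: exp_add[symmetric])
  then have "1 / (sqrt (2 * pi) * \<sigma>) * exp (- (y - v)\<^sup>2 / (2 * \<sigma>\<^sup>2))
      \<le> 1 / (sqrt (2 * pi) * \<sigma>) * (exp (1 / 2) * exp (- y\<^sup>2 / (2 * \<tau>\<^sup>2)))"
    using \<sigma> by (intro mult_left_mono) auto
  then show ?thesis
    using \<sigma> \<tau>0 by (simp add: normal_density_def real_sqrt_mult field_simps)
qed

lemma nn_integral_normal_law_translate_le:
  assumes \<sigma>: "0 < \<sigma>" and v: "\<bar>v\<bar> \<le> q" and \<tau>: "\<tau> = sqrt (\<sigma>\<^sup>2 + q\<^sup>2)"
    and f [measurable]: "f \<in> borel_measurable borel"
  shows "(\<integral>\<^sup>+x. f (v + x) \<partial>normal_law \<sigma>) \<le> ennreal (\<tau> / \<sigma> * exp (1 / 2)) * (\<integral>\<^sup>+x. f x \<partial>normal_law \<tau>)"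
proof -
  have \<tau>0: "0 < \<tau>"
    unfolding \<tau> using \<sigma> by (simp add: add_pos_nonneg)
  have "(\<integral>\<^sup>+x. f (v + x) \<partial>normal_law \<sigma>) = (\<integral>\<^sup>+x. ennreal (normal_density 0 \<sigma> x) * f (v + x) \<partial>lborel)"
    by (simp add: normal_law_def nn_integral_density)
  also have "\<dots> = (\<integral>\<^sup>+y. ennreal (normal_density 0 \<sigma> (y - v)) * f y \<partial>lborel)"
    by (subst nn_integral_real_affine[where c = 1 and t = "- v"]) auto
  also have "\<dots> \<le> (\<integral>\<^sup>+y. ennreal (\<tau> / \<sigma> * exp (1 / 2)) * (ennreal (normal_density 0 \<tau> y) * f y) \<partial>lborel)"
  proof (rule nn_integral_mono)
    fix y
    have "ennreal (normal_density 0 \<sigma> (y - v)) \<le> ennreal (\<tau> / \<sigma> * exp (1 / 2)) * ennreal (normal_density 0 \<tau> y)"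
      using normal_density_translate_le[OF \<sigma> v \<tau>, of y] \<sigma> \<tau>0
      by (simp add: ennreal_mult[symmetric] normal_density_nonneg ennreal_leI)
    then show "ennreal (normal_density 0 \<sigma> (y - v)) * f y
        \<le> ennreal (\<tau> / \<sigma> * exp (1 / 2)) * (ennreal (normal_density 0 \<tau> y) * f y)"
      unfolding mult.assoc[symmetric] by (rule mult_right_mono) simp
  qed
  also have "\<dots> = ennreal (\<tau> / \<sigma> * exp (1 / 2)) * (\<integral>\<^sup>+x. f x \<partial>normal_law \<tau>)"
    by (simp add: normal_law_def nn_integral_density nn_integral_cmult)
  finally show ?thesis .
qed

text \<open>Domination tensorizes: the coordinates are replaced one after another, each at the cost
  of a factor \<open>L\<close>. The shifts may differ, since \<open>L\<close> and
  \<open>\<nu>\<close> are common to all coordinates.\<close>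

lemma nn_integral_PiM_translate_le:
  fixes v :: "'i \<Rightarrow> real" and f :: "('i \<Rightarrow> real) \<Rightarrow> ennreal"
  assumes "finite I" and \<mu>: "sigma_finite_measure \<mu>" "sets \<mu> = sets borel"
    and \<nu>: "sigma_finite_measure \<nu>" "sets \<nu> = sets borel"
    and le: "\<And>i g. i \<in> I \<Longrightarrow> g \<in> borel_measurable borel \<Longrightarrow>
      (\<integral>\<^sup>+x. g (v i + x) \<partial>\<mu>) \<le> L * (\<integral>\<^sup>+x. g x \<partial>\<nu>)"
    and f: "f \<in> borel_measurable (\<Pi>\<^sub>M i\<in>I. borel)"
  shows "(\<integral>\<^sup>+x. f (\<lambda>i\<in>I. v i + x i) \<partial>(\<Pi>\<^sub>M i\<in>I. \<mu>)) \<le> L ^ card I * (\<integral>\<^sup>+x. f x \<partial>(\<Pi>\<^sub>M i\<in>I. \<nu>))"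
  using assms(1) le f
proof (induction I arbitrary: f rule: finite_induct)
  case empty
  then show ?case by (simp add: PiM_empty nn_integral_count_space_finite)
next
  case (insert i I)
  note [measurable_cong] = \<mu>(2) \<nu>(2)
  note [measurable] = insert.prems(2)
  interpret \<mu>: product_sigma_finite "\<lambda>_. \<mu>" using \<mu>(1) by (simp add: product_sigma_finite_def)
  interpret \<nu>: product_sigma_finite "\<lambda>_. \<nu>" using \<nu>(1) by (simp add: product_sigma_finite_def)
  interpret \<mu>I: sigma_finite_measure \<mu> by (rule \<mu>(1))
  interpret \<nu>I: sigma_finite_measure \<nu> by (rule \<nu>(1))
  have f_meas: "f \<in> borel_measurable (\<Pi>\<^sub>M i\<in>insert i I. \<mu>)" "f \<in> borel_measurable (\<Pi>\<^sub>M i\<in>insert i I. \<nu>)"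
    by measurable
  \<comment> \<open>In \<open>h\<close> the new coordinate is already integrated against
    \<open>\<nu>\<close>, so the induction hypothesis for \<open>h\<close> replaces the remaining
    ones.\<close>
  define h where "h x = (\<integral>\<^sup>+y. f (x(i := y)) \<partial>\<nu>)" for x
  have h [measurable]: "h \<in> borel_measurable (\<Pi>\<^sub>M i\<in>I. borel)"
    unfolding h_def by measurable
  have upd: "(\<lambda>j\<in>insert i I. v j + (x(i := y)) j) = (\<lambda>j\<in>I. v j + x j)(i := v i + y)" for x y
    using insert.hyps by (auto simp: fun_eq_iff)
  have "(\<integral>\<^sup>+x. f (\<lambda>j\<in>insert i I. v j + x j) \<partial>(\<Pi>\<^sub>M i\<in>insert i I. \<mu>)) =
      (\<integral>\<^sup>+x. (\<integral>\<^sup>+y. f ((\<lambda>j\<in>I. v j + x j)(i := v i + y)) \<partial>\<mu>) \<partial>(\<Pi>\<^sub>M i\<in>I. \<mu>))"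
    unfolding upd[symmetric] using insert.hyps by (intro \<mu>.product_nn_integral_insert) measurable
  also have "\<dots> \<le> (\<integral>\<^sup>+x. L * h (\<lambda>j\<in>I. v j + x j) \<partial>(\<Pi>\<^sub>M i\<in>I. \<mu>))"
  proof (rule nn_integral_mono)
    fix x assume "x \<in> space (\<Pi>\<^sub>M i\<in>I. \<mu>)"
    have [measurable]: "(\<lambda>j\<in>I. v j + x j) \<in> space (\<Pi>\<^sub>M i\<in>I. borel)"
      by (simp add: space_PiM)
    have "(\<lambda>y. f ((\<lambda>j\<in>I. v j + x j)(i := y))) \<in> borel_measurable borel"
      by measurable
    from insert.prems(1)[OF _ this]
    show "(\<integral>\<^sup>+y. f ((\<lambda>j\<in>I. v j + x j)(i := v i + y)) \<partial>\<mu>) \<le> L * h (\<lambda>j\<in>I. v j + x j)"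
      unfolding h_def by simp
  qed
  also have "\<dots> = L * (\<integral>\<^sup>+x. h (\<lambda>j\<in>I. v j + x j) \<partial>(\<Pi>\<^sub>M i\<in>I. \<mu>))"
    by (intro nn_integral_cmult) measurable
  also have "\<dots> \<le> L * (L ^ card I * (\<integral>\<^sup>+x. h x \<partial>(\<Pi>\<^sub>M i\<in>I. \<nu>)))"
    using insert.prems(1) by (intro mult_left_mono insert.IH) auto
  also have "(\<integral>\<^sup>+x. h x \<partial>(\<Pi>\<^sub>M i\<in>I. \<nu>)) = (\<integral>\<^sup>+x. f x \<partial>(\<Pi>\<^sub>M i\<in>insert i I. \<nu>))"
    unfolding h_def using insert.hyps by (intro \<nu>.product_nn_integral_insert[symmetric]) measurable
  finally show ?case
    using insert.hyps by (simp add: mult.assoc)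
qed

subsection \<open>The comb model\<close>

text \<open>The spine is \<open>1, \<dots>, 2k\<close> with root \<open>1\<close>; the leaf attached to \<open>i\<close> is \<open>i + 2k\<close>.\<close>

definition comb_parent :: "nat \<Rightarrow> nat \<Rightarrow> nat" where
  "comb_parent k i = (if i \<le> 2 * k then i - 1 else i - 2 * k)"

lemma comb_parent_spine: "1 \<le> i \<Longrightarrow> i \<le> 2 * k \<Longrightarrow> (comb_parent k ^^ (i - 1)) i = 1"
proof (induction i)
  case (Suc i)
  show ?case
  proof (cases "i = 0")
    case False
    then obtain j where j: "i = Suc j" by (cases i) auto
    have "(comb_parent k ^^ Suc j) (Suc i) = (comb_parent k ^^ j) i"
      using Suc.prems by (simp add: funpow_Suc_right comb_parent_def del: funpow.simps)
    then show ?thesis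
      using Suc j by simp
  qed simp
qed simp

lemma rooted_binary_tree_comb:
  assumes "0 < k"
  shows "rooted_binary_tree (4 * k) 1 (comb_parent k)"
  unfolding rooted_binary_tree_def
proof (intro conjI ballI)
  show "1 \<in> {1..4 * k}" using assms by simp
next
  fix i assume "i \<in> {1..4 * k} - {1}"
  then show "comb_parent k i \<in> {1..4 * k}"
    by (auto simp: comb_parent_def)
next
  fix i assume i: "i \<in> {1..4 * k}"
  show "\<exists>j. (comb_parent k ^^ j) i = 1"
  proof (cases "i \<le> 2 * k")
    case True
    with i show ?thesis using comb_parent_spine[of i k] by auto
  next
    case False
    \<comment> \<open>A leaf first steps to its spine node \<open>i - 2 * k\<close>, from which the
      root is \<open>i - 2 * k - 1\<close> steps away.\<close>
    with i have "(comb_parent k ^^ (i - 2 * k - 1)) (comb_parent k i) = 1"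
      using comb_parent_spine[of "i - 2 * k" k] by (simp add: comb_parent_def)
    then have "(comb_parent k ^^ Suc (i - 2 * k - 1)) i = 1"
      by (simp only: funpow_Suc_right comp_apply)
    then show ?thesis by blast
  qed
next
  fix j assume "j \<in> {1..4 * k}"
  \<comment> \<open>Possible children of \<open>j\<close> are the next spine node and the attached
    leaf.\<close>
  have "{i \<in> {1..4 * k} - {1}. comb_parent k i = j} \<subseteq> {j + 1, j + 2 * k}"
    by (auto simp: comb_parent_def split: if_splits)
  then have "card {i \<in> {1..4 * k} - {1}. comb_parent k i = j} \<le> card {j + 1, j + 2 * k}"
    by (rule card_mono[rotated]) simp
  also have "\<dots> \<le> 2" by (simp add: card_insert_if)
  finally show "card {i \<in> {1..4 * k} - {1}. comb_parent k i = j} \<le> 2" .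
qed

definition comb_supports :: "nat \<Rightarrow> nat set set" where
  "comb_supports k = (\<lambda>L. {1..2 * k} \<union> L) ` {L. L \<subseteq> {2 * k + 1..4 * k} \<and> card L = k}"

text \<open>All parents lie on the spine, which every support contains, so closure under parents
  holds for any choice of leaves.\<close>

lemma comb_supports_subset_tree_model: "comb_supports k \<subseteq> tree_model (4 * k) 1 (comb_parent k) (3 * k)"
proof
  fix S assume "S \<in> comb_supports k"
  then obtain L where L: "S = {1..2 * k} \<union> L" "L \<subseteq> {2 * k + 1..4 * k}" "card L = k"
    by (auto simp: comb_supports_def)
  have "card S = card {1..2 * k} + card L"
    unfolding L(1) using L(2) finite_subset[OF L(2)] by (intro card_Un_disjoint) auto
  moreover have "comb_parent k i \<in> S" if "i \<in> S" "i \<noteq> 1" for i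
  proof -
    have "1 \<le> i" "i \<le> 4 * k"
      using that(1) L by auto
    then have "comb_parent k i \<in> {1..2 * k}"
      using that(2) by (auto simp: comb_parent_def)
    then show ?thesis unfolding L(1) by blast
  qed
  ultimately show "S \<in> tree_model (4 * k) 1 (comb_parent k) (3 * k)"
    using L by (auto simp: tree_model_def)
qed

text \<open>The supports are counted by the central binomial coefficient, which is at least
  \<open>4 ^ k / (2 * k)\<close>, and \<open>2 * k \<le> 2 ^ k\<close>.\<close>

lemma card_comb_supports:
  assumes "0 < k"
  shows "2 ^ k \<le> card (comb_supports k)"
proof -
  have "inj_on (\<lambda>L. {1..2 * k} \<union> L) {L. L \<subseteq> {2 * k + 1..4 * k} \<and> card L = k}"
  proof (rule inj_onI)
    fix L L' assume L: "L \<in> {L. L \<subseteq> {2 * k + 1..4 * k} \<and> card L = k}" "L' \<in> {L. L \<subseteq> {2 * k + 1..4 * k} \<and> card L = k}"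
      and eq: "{1..2 * k} \<union> L = {1..2 * k} \<union> L'"
    from L have "L = ({1..2 * k} \<union> L) - {1..2 * k}" "L' = ({1..2 * k} \<union> L') - {1..2 * k}"
      by fastforce+
    with eq show "L = L'" by metis
  qed
  then have "card (comb_supports k) = (2 * k) choose k"
    unfolding comb_supports_def by (simp add: card_image n_subsets)
  moreover have "(2 ^ k :: real) \<le> (2 * k) choose k"
  proof -
    have "2 * k \<le> 2 ^ k"
      using assms by (induction k rule: nat_induct_non_zero) auto
    then have "real (2 * k) \<le> 2 ^ k"
      by (metis of_nat_le_iff of_nat_numeral of_nat_power)
    then have "2 * real k * 2 ^ k \<le> 2 ^ k * 2 ^ k"
      by simp
    also have "\<dots> = (4 :: real) ^ k"
      by (simp add: power_mult_distrib[symmetric])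
    finally have "(2 ^ k :: real) \<le> 4 ^ k / (2 * real k)"
      using assms by (simp add: field_simps)
    then show ?thesis
      using central_binomial_lower_bound[OF assms] by linarith
  qed
  ultimately show ?thesis
    by (metis of_nat_le_iff of_nat_numeral of_nat_power)
qed

section \<open>Signals supported on the comb and their separation\<close>

definition codeword :: "nat \<Rightarrow> real \<Rightarrow> nat set \<Rightarrow> nat \<Rightarrow> real" where
  "codeword d a S = (\<lambda>i\<in>{1..d}. if i \<in> S then a else 0)"

definition codebook :: "nat \<Rightarrow> real \<Rightarrow> (nat \<Rightarrow> real) set" where
  "codebook k a = codeword (4 * k) a ` comb_supports k"

lemma support_codeword: "a \<noteq> 0 \<Longrightarrow> S \<subseteq> {1..d} \<Longrightarrow> support d (codeword d a S) = S"
  by (auto simp: support_def codeword_def)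

lemma comb_supports_subset: "S \<in> comb_supports k \<Longrightarrow> S \<subseteq> {1..4 * k}"
  using comb_supports_subset_tree_model by (auto simp: tree_model_def)

lemma finite_comb_supports: "finite (comb_supports k)"
  by (simp add: comb_supports_def)

lemma card_codebook:
  assumes "a \<noteq> 0" "0 < k"
  shows "2 ^ k \<le> card (codebook k a)"
proof -
  have "inj_on (codeword (4 * k) a) (comb_supports k)"
    using support_codeword[OF assms(1) comb_supports_subset] by (intro inj_onI) metis
  then show ?thesis
    using card_comb_supports[OF assms(2)] by (simp add: codebook_def card_image)
qed

lemma signal_set_codebook:
  assumes "a \<noteq> 0" "0 < k"
  shows "signal_set (4 * k) (tree_model (4 * k) 1 (comb_parent k) (3 * k)) (codebook k a)"
  unfolding signal_set_def
proof (intro conjI exI[of _ "{a}"])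
  show "codebook k a \<noteq> {}"
    using card_codebook[OF assms] by auto
  show "codebook k a \<subseteq> {\<beta> \<in> {1..4 * k} \<rightarrow>\<^sub>E UNIV. support (4 * k) \<beta> \<in> tree_model (4 * k) 1 (comb_parent k) (3 * k) \<and>
      \<beta> ` support (4 * k) \<beta> \<subseteq> {a}}"
  proof
    fix \<beta> assume "\<beta> \<in> codebook k a"
    then obtain S where S: "S \<in> comb_supports k" "\<beta> = codeword (4 * k) a S"
      by (auto simp: codebook_def)
    have "support (4 * k) \<beta> = S"
      unfolding S(2) using assms(1) comb_supports_subset[OF S(1)] by (rule support_codeword)
    moreover have "\<beta> ` S \<subseteq> {a}"
      using comb_supports_subset[OF S(1)] by (auto simp: S(2) codeword_def)
    moreover have "\<beta> \<in> {1..4 * k} \<rightarrow>\<^sub>E UNIV"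
      by (simp add: S(2) codeword_def)
    ultimately show "\<beta> \<in> {\<beta> \<in> {1..4 * k} \<rightarrow>\<^sub>E UNIV.
        support (4 * k) \<beta> \<in> tree_model (4 * k) 1 (comb_parent k) (3 * k) \<and> \<beta> ` support (4 * k) \<beta> \<subseteq> {a}}"
      using S(1) comb_supports_subset_tree_model by blast
  qed
qed (auto simp: codebook_def finite_comb_supports)

lemma codebook_values: "\<beta> \<in> codebook k a \<Longrightarrow> i \<in> {1..4 * k} \<Longrightarrow> \<beta> i \<in> {0, a}"
  by (auto simp: codebook_def codeword_def)

lemma codebook_in_PiE: "\<beta> \<in> codebook k a \<Longrightarrow> \<beta> \<in> {1..4 * k} \<rightarrow>\<^sub>E UNIV"
  by (auto simp: codebook_def codeword_def)

text \<open>Entries are 0 or \<open>a\<close>, so any discrepancy is a full \<open>a\<close>. A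
  single coordinate suffices, as it bounds the Euclidean distance from below.\<close>

lemma codebook_separated:
  assumes "\<beta> \<in> codebook k a" "\<beta>' \<in> codebook k a" "\<beta> \<noteq> \<beta>'"
  obtains j where "j \<in> {1..4 * k}" "\<bar>\<beta> j - \<beta>' j\<bar> = \<bar>a\<bar>"
proof -
  obtain j where "j \<in> {1..4 * k}" "\<beta> j \<noteq> \<beta>' j"
    using PiE_ext[OF codebook_in_PiE codebook_in_PiE] assms by metis
  then show ?thesis
    using that[of j] codebook_values[OF assms(1), of j] codebook_values[OF assms(2), of j] by force
qed

text \<open>All signals share one norm, so normalization rescales the whole code by one factor and
  preserves its separation.\<close>

lemma L2_set_codebook:
  assumes "\<beta> \<in> codebook k a" "a \<noteq> 0"
  shows "L2_set \<beta> {1..4 * k} = \<bar>a\<bar> * sqrt (3 * k)"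
proof -
  obtain S where S: "S \<in> comb_supports k" "\<beta> = codeword (4 * k) a S"
    using assms(1) by (auto simp: codebook_def)
  have "card S = 3 * k"
    using S(1) comb_supports_subset_tree_model by (auto simp: tree_model_def)
  have "(\<Sum>i\<in>{1..4 * k}. (\<beta> i)\<^sup>2) = (\<Sum>i\<in>S. a\<^sup>2)"
    using comb_supports_subset[OF S(1)]
    by (intro sum.mono_neutral_cong_right) (auto simp: S(2) codeword_def)
  also have "\<dots> = a\<^sup>2 * (3 * k)"
    using \<open>card S = 3 * k\<close> by simp
  finally show ?thesis
    by (simp add: L2_set_def real_sqrt_mult)
qed

text \<open>Read with \<open>w\<close> as the estimate: it cannot be within \<epsilon> of two
  signals that differ by \<open>2 * \<epsilon>\<close> in a coordinate, which makes success sets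
  disjoint.\<close>

lemma L2_set_close_imp_coordinate_close:
  assumes "finite A" "j \<in> A" "L2_set (\<lambda>i. u i - w i) A < \<epsilon>" "L2_set (\<lambda>i. v i - w i) A < \<epsilon>"
  shows "\<bar>u j - v j\<bar> < 2 * \<epsilon>"
proof -
  have "\<bar>f j\<bar> \<le> L2_set f A" for f
    using member_le_L2_set[OF assms(1,2), of "\<lambda>i. \<bar>f i\<bar>"] by (simp add: L2_set_def)
  from this[of "\<lambda>i. u i - w i"] this[of "\<lambda>i. v i - w i"] assms(3,4) show ?thesis
    by linarith
qed

section \<open>Consequences of the little-o conditions on the sample size\<close>

lemma eventually_sample_size_small_log:
  assumes "(\<lambda>m. real (n m)) \<in> o(\<lambda>m. real (3 * Suc m) / ln (real (3 * Suc m)))"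
  shows "\<forall>\<^sub>F m in sequentially. 2 * real (3 * Suc m) ^ (3 * n m) \<le> 2 ^ Suc m"
proof -
  \<comment> \<open>The exponent \<open>3 * n m\<close> anticipates a loss of at most
    \<open>(3 * k) ^ 3\<close> per observation. With \<open>k = Suc m\<close>, this \<open>c\<close>
    makes \<open>3 * n m * ln s\<close> at most half of \<open>k * ln 2\<close>; the other half pays
    for the leading factor 2 as soon as \<open>k\<close> is at least 2, that is
    \<open>1 \<le> m\<close>.\<close>
  define c :: real where "c = ln 2 / 18"
  have c: "0 < c" by (simp add: c_def)
  have "\<forall>\<^sub>F m in sequentially. 1 \<le> m"
    by (rule eventually_ge_at_top)
  with landau_o.smallD[OF assms c] show ?thesis
  proof eventually_elim
    case (elim m)
    define s where "s = real (3 * Suc m)"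
    have s: "0 < ln s" "0 < s" by (auto simp: s_def)
    have "n m * ln s \<le> c * s"
      using elim(1) s unfolding s_def[symmetric] by (simp add: field_simps)
    also have "c * s = ln 2 / 6 * Suc m"
      by (simp add: c_def s_def field_simps)
    finally have *: "3 * n m * ln s \<le> (ln 2 / 2) * Suc m"
      by simp
    have "ln (2 * s ^ (3 * n m)) = ln 2 + 3 * n m * ln s"
      using s by (simp add: ln_mult ln_realpow)
    also have "\<dots> \<le> ln 2 + (ln 2 / 2) * Suc m"
      using * by simp
    also have "\<dots> = ln 2 * (1 + Suc m / 2)"
      by (simp add: algebra_simps)
    also have "\<dots> \<le> ln 2 * Suc m"
      using elim(2) by (intro mult_left_mono) auto
    also have "\<dots> = ln (2 ^ Suc m)"
      by (simp add: ln_realpow del: power_Suc)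
    finally show ?case
      using s unfolding s_def[symmetric] by (subst (asm) ln_le_cancel_iff) auto
  qed
qed

lemma eventually_sample_size_small:
  assumes "(\<lambda>m. real (n m)) \<in> o(\<lambda>m. real (3 * Suc m))"
  shows "\<forall>\<^sub>F m in sequentially. 2 * 2 ^ n m \<le> (2 ^ Suc m :: nat)"
proof -
  have "\<forall>\<^sub>F m in sequentially. 1 \<le> m"
    by (rule eventually_ge_at_top)
  \<comment> \<open>The constant gives \<open>n m\<close> at most half of \<open>Suc m\<close>,
    hence at most \<open>m\<close>; the one remaining power of 2 pays for the leading factor
    2.\<close>
  moreover have "\<forall>\<^sub>F m in sequentially. norm (real (n m)) \<le> 1 / 6 * norm (real (3 * Suc m))"
    by (rule landau_o.smallD[OF assms]) simp
  ultimately show ?thesis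
  proof eventually_elim
    case (elim m)
    then have "n m \<le> m" by simp
    then show ?case by simp
  qed
qed

subsection \<open>Designs and observations\<close>

lemma mat_component_measurable:
  "i \<in> {1..n} \<Longrightarrow> j \<in> {1..d} \<Longrightarrow> (\<lambda>X. X (i, j)) \<in> borel_measurable (mat_space n d)"
  unfolding mat_space_def by (rule measurable_component_singleton) simp

lemma vec_component_measurable:
  "i \<in> {1..n} \<Longrightarrow> (\<lambda>e. e i) \<in> borel_measurable (vec_space n)"
  unfolding vec_space_def by (rule measurable_component_singleton)

lemma measurable_vec_spaceI:
  "(\<And>i. i \<in> {1..n} \<Longrightarrow> (\<lambda>x. f x i) \<in> borel_measurable M) \<Longrightarrow> (\<lambda>x. \<lambda>i\<in>{1..n}. f x i) \<in> M \<rightarrow>\<^sub>M vec_space n"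
  unfolding vec_space_def by (rule measurable_restrict)

lemma linear_form_measurable:
  assumes "i \<in> {1..n}"
  shows "(\<lambda>x. \<Sum>j\<in>{1..d}. fst x (i, j) * \<beta> j) \<in> borel_measurable (mat_space n d \<Otimes>\<^sub>M N)"
  using assms
  by (intro borel_measurable_sum borel_measurable_times measurable_compose[OF measurable_fst mat_component_measurable])
    auto

lemma noiseless_obs_measurable:
  "(\<lambda>(X, e). noiseless_obs n d X \<beta> e) \<in> mat_space n d \<Otimes>\<^sub>M vec_space n \<rightarrow>\<^sub>M vec_space n"
  unfolding noiseless_obs_def mat_vec_def case_prod_beta
  by (intro measurable_vec_spaceI linear_form_measurable)

lemma noisy_form_measurable:
  assumes "i \<in> {1..n}"
  shows "(\<lambda>x. mat_vec n d (fst x) \<beta> i + snd x i) \<in> borel_measurable (mat_space n d \<Otimes>\<^sub>M vec_space n)"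
  unfolding mat_vec_def restrict_apply'[OF assms]
  using assms by (intro borel_measurable_add linear_form_measurable
      measurable_compose[OF measurable_snd vec_component_measurable])

lemma noisy_obs_measurable:
  "(\<lambda>(X, e). noisy_obs n d X \<beta> e) \<in> mat_space n d \<Otimes>\<^sub>M vec_space n \<rightarrow>\<^sub>M vec_space n"
  unfolding noisy_obs_def case_prod_beta by (intro measurable_vec_spaceI noisy_form_measurable)

lemma sign_at0_measurable: "sign_at0 z \<in> borel_measurable borel"
  unfolding sign_at0_def by measurable

lemma one_bit_obs_measurable:
  "(\<lambda>(X, e). one_bit_obs z n d X \<beta> e) \<in> mat_space n d \<Otimes>\<^sub>M vec_space n \<rightarrow>\<^sub>M vec_space n"
  unfolding one_bit_obs_def case_prod_beta
  by (intro measurable_vec_spaceI measurable_compose[OF noisy_form_measurable sign_at0_measurable])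

lemma prob_space_iid:
  assumes "prob_space \<mu>"
  shows "prob_space (iid_vec n \<mu>)" "prob_space (iid_mat n d \<mu>)"
  using assms by (auto simp: iid_vec_def iid_mat_def intro!: prob_space_PiM)

lemma sets_iid:
  assumes "sets \<mu> = sets borel"
  shows "sets (iid_vec n \<mu>) = sets (vec_space n)" "sets (iid_mat n d \<mu>) = sets (mat_space n d)"
  using assms by (auto simp: iid_vec_def iid_mat_def vec_space_def mat_space_def intro!: sets_PiM_cong)

lemma gaussian_design:
  assumes "0 < n"
  shows "prob_space (gaussian_design n d)" "sets (gaussian_design n d) = sets (mat_space n d)"
  using assms by (auto simp: gaussian_design_def prob_space_iid prob_space_normal_law sets_iid)

lemma gaussian_noise:
  assumes "0 < \<sigma>"
  shows "prob_space (gaussian_noise n \<sigma>)" "sets (gaussian_noise n \<sigma>) = sets (vec_space n)"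
  using assms by (auto simp: gaussian_noise_def prob_space_iid prob_space_normal_law sets_iid)

lemma no_noise:
  shows "prob_space (no_noise n)" "sets (no_noise n) = sets (vec_space n)"
  by (auto simp: no_noise_def vec_space_def space_PiM intro!: prob_space_return)

lemma sets_sign_law: "sets (sign_law a) = sets borel"
  by (simp add: sign_law_def)

lemma sign_design:
  shows "prob_space (sign_design n d)" "sets (sign_design n d) = sets (mat_space n d)"
proof -
  have "prob_space (sign_law a)" for a
    unfolding sign_law_def by (intro prob_space.prob_space_distr prob_space_measure_pmf) simp
  then show "prob_space (sign_design n d)" "sets (sign_design n d) = sets (mat_space n d)"
    by (auto simp: sign_design_def prob_space_iid sets_iid sets_sign_law)
qed

lemma AE_sign_design:
  "AE X in sign_design n d. \<forall>ij\<in>{1..n} \<times> {1..d}. X ij \<in> {- (1 / sqrt n), 1 / sqrt n}"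
  unfolding sign_design_def iid_mat_def
proof (intro AE_finite_allI finite_cartesian_product finite_atLeastAtMost AE_PiM_component)
  let ?a = "1 / sqrt n"
  show "prob_space (sign_law ?a)"
    unfolding sign_law_def by (intro prob_space.prob_space_distr prob_space_measure_pmf) simp
  show "AE x in sign_law ?a. x \<in> {- ?a, ?a}"
    unfolding sign_law_def by (subst AE_distr_iff) (auto simp: AE_measure_pmf_iff set_pmf_of_set)
qed

text \<open>By extensionality the singleton is a finite box of closed one-point sets; this makes
  exact recovery an event.\<close>

lemma singleton_vec_space: "\<beta> \<in> {1..d} \<rightarrow>\<^sub>E UNIV \<Longrightarrow> {\<beta>} \<in> sets (vec_space d)"
  unfolding vec_space_def
  by (subst PiE_singleton[symmetric, of \<beta> "{1..d}"]) (auto simp only: PiE_iff intro!: sets_PiM_I_finite borel_closed closed_singleton)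

lemma pred_eq_vec_space:
  assumes "\<beta> \<in> {1..d} \<rightarrow>\<^sub>E UNIV"
  shows "Measurable.pred (vec_space d) (\<lambda>b. b = \<beta>)"
proof -
  have "{b \<in> space (vec_space d). b = \<beta>} = {\<beta>}"
    using assms by (auto simp: vec_space_def space_PiM)
  then show ?thesis
    using singleton_vec_space[OF assms] by (simp add: pred_def)
qed

lemma L2_set_measurable:
  "(\<And>i. i \<in> A \<Longrightarrow> (\<lambda>x. f x i) \<in> borel_measurable M) \<Longrightarrow> (\<lambda>x. L2_set (f x) A) \<in> borel_measurable M"
  unfolding L2_set_def
  by (intro measurable_compose[OF _ borel_measurable_sqrt] borel_measurable_sum borel_measurable_power)

section \<open>Failure of recovery when the observation takes few values\<close>

lemma card_noiseless_obs_le: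
  assumes X: "\<forall>ij\<in>{1..n} \<times> {1..4 * k}. X ij \<in> {- a, a}"
  shows "card ((\<lambda>\<beta>. noiseless_obs n (4 * k) X \<beta> e) ` codebook k 1) \<le> (8 * k + 1) ^ n"
proof -
  \<comment> \<open>Entries \<open>a\<close> or \<open>- a\<close> meet signal entries 0 or 1, so
    each coordinate is \<open>a\<close> times an integer of modulus at most \<open>4 * k\<close>:
    \<open>8 * k + 1\<close> candidates.\<close>
  let ?V = "(\<lambda>c. a * real_of_int c) ` {- int (4 * k)..int (4 * k)}"
  have "(\<lambda>\<beta>. noiseless_obs n (4 * k) X \<beta> e) ` codebook k 1 \<subseteq> (\<Pi>\<^sub>E i\<in>{1..n}. ?V)"
  proof (intro image_subsetI PiE_I)
    fix \<beta> i assume \<beta>: "\<beta> \<in> codebook k 1" and i: "i \<in> {1..n}"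
    have "\<exists>c. \<bar>c\<bar> \<le> 1 \<and> X (i, j) * \<beta> j = a * real_of_int c" if j: "j \<in> {1..4 * k}" for j
    proof -
      have "X (i, j) \<in> {- a, a}" using X i j by auto
      with codebook_values[OF \<beta> j] consider "X (i, j) * \<beta> j = 0" | "X (i, j) * \<beta> j = a" | "X (i, j) * \<beta> j = - a"
        by auto
      then show ?thesis
        by cases (auto intro: exI[of _ 0] exI[of _ 1] exI[of _ "-1"])
    qed
    then obtain c where c: "\<And>j. j \<in> {1..4 * k} \<Longrightarrow> \<bar>c j\<bar> \<le> 1"
      "\<And>j. j \<in> {1..4 * k} \<Longrightarrow> X (i, j) * \<beta> j = a * real_of_int (c j)"
      by metis
    have "\<bar>\<Sum>j\<in>{1..4 * k}. c j\<bar> \<le> (\<Sum>j\<in>{1..4 * k}. 1)"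
      by (rule order_trans[OF sum_abs sum_mono]) (rule c)
    then have "(\<Sum>j\<in>{1..4 * k}. c j) \<in> {- int (4 * k)..int (4 * k)}"
      by auto
    moreover have "(\<Sum>j\<in>{1..4 * k}. X (i, j) * \<beta> j) = a * real_of_int (\<Sum>j\<in>{1..4 * k}. c j)"
      by (simp add: c(2) sum_distrib_left)
    ultimately show "noiseless_obs n (4 * k) X \<beta> e i \<in> ?V"
      unfolding noiseless_obs_def mat_vec_def restrict_apply'[OF i] by (rule rev_image_eqI)
  next
    fix \<beta> i assume "i \<notin> {1..n}"
    then show "noiseless_obs n (4 * k) X \<beta> e i = undefined"
      by (simp only: noiseless_obs_def mat_vec_def restrict_apply if_False)
  qed
  then have "card ((\<lambda>\<beta>. noiseless_obs n (4 * k) X \<beta> e) ` codebook k 1) \<le> card (\<Pi>\<^sub>E i\<in>{1..n}. ?V)"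
    by (rule card_mono[rotated]) (auto intro!: finite_PiE)
  also have "\<dots> = card ?V ^ n"
    by (simp add: card_PiE)
  also have "card ?V \<le> card {- int (4 * k)..int (4 * k)}"
    by (rule card_image_le) simp
  also have "card {- int (4 * k)..int (4 * k)} = 8 * k + 1"
    by simp
  finally show ?thesis
    by (simp add: power_mono)
qed

lemma card_one_bit_obs_le:
  assumes "z \<in> {- 1, 1}"
  shows "card ((\<lambda>\<beta>. one_bit_obs z n d X \<beta> e) ` B) \<le> 2 ^ n"
proof -
  have "(\<lambda>\<beta>. one_bit_obs z n d X \<beta> e) ` B \<subseteq> (\<Pi>\<^sub>E i\<in>{1..n}. {- 1, 1})"
    using assms by (auto simp: one_bit_obs_def sign_at0_def sgn_if split: if_splits)
  then have "card ((\<lambda>\<beta>. one_bit_obs z n d X \<beta> e) ` B) \<le> card (\<Pi>\<^sub>E i\<in>{1..n}. {- 1, 1 :: real})"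
    by (rule card_mono[rotated]) (auto intro!: finite_PiE)
  also have "\<dots> = 2 ^ n"
    by (simp add: card_PiE numeral_2_eq_2)
  finally show ?thesis .
qed

lemma finite_codebook: "finite (codebook k a)"
  by (simp add: codebook_def finite_comb_supports)

lemma codebook_nonempty: "a \<noteq> 0 \<Longrightarrow> 0 < k \<Longrightarrow> codebook k a \<noteq> {}"
  using card_codebook[of a k] by auto

lemma noiseless_recovery_fails:
  assumes k: "0 < k" and K: "K \<in> procedures n (4 * k)" and small: "2 * (8 * k + 1) ^ n \<le> (2 ^ k :: nat)"
  shows "\<P>((\<beta>, X, e, b) in joint_law (4 * k) (codebook k 1) (sign_design n (4 * k))
    (no_noise n) (noiseless_obs n (4 * k)) K. \<beta> \<noteq> b) \<ge> 1 / 2"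
proof -
  interpret inference_model n "4 * k" "codebook k 1" "sign_design n (4 * k)" "no_noise n" "noiseless_obs n (4 * k)" K
    using k K by (intro inference_model.intro)
      (simp_all add: finite_codebook codebook_nonempty sign_design no_noise noiseless_obs_measurable)
  interpret D: prob_space "no_noise n" by (rule prob_noise)
  show ?thesis
  proof (rule prob_ge_half_if_few_observations)
    let ?a = "1 / sqrt n"
    \<comment> \<open>The almost sure statement concerns X alone and is transferred to the product
      through its first marginal.\<close>
    have "AE X in distr (sign_design n (4 * k) \<Otimes>\<^sub>M no_noise n) (sign_design n (4 * k)) fst.
        \<forall>ij\<in>{1..n} \<times> {1..4 * k}. X ij \<in> {- ?a, ?a}"
      by (subst D.distr_pair_fst) (rule AE_sign_design)
    from AE_distrD[OF measurable_fst this]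
    show "AE (X, e) in sign_design n (4 * k) \<Otimes>\<^sub>M no_noise n.
        card ((\<lambda>\<beta>. noiseless_obs n (4 * k) X \<beta> e) ` codebook k 1) \<le> (8 * k + 1) ^ n"
      unfolding case_prod_beta by eventually_elim (rule card_noiseless_obs_le)
  next
    fix \<beta> assume "\<beta> \<in> codebook k 1"
    from pred_intros_logic(2)[OF pred_eq_vec_space[OF codebook_in_PiE[OF this]]]
    show "Measurable.pred (vec_space (4 * k)) (\<lambda>b. \<beta> \<noteq> b)"
      by (simp only: eq_commute[of \<beta>])
  next
    show "2 * (8 * k + 1) ^ n \<le> card (codebook k 1)"
      using small card_codebook[of 1 k] k by linarith
  qed auto
qed

definition noise_laws :: "nat \<Rightarrow> (nat \<Rightarrow> real) measure set" where
  "noise_laws n = insert (no_noise n) {gaussian_noise n \<sigma> |\<sigma>. 0 < \<sigma>}"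

lemma one_bit_inference_model:
  assumes "0 < k" "0 < n" "K \<in> procedures n (4 * k)" "N \<in> noise_laws n"
  shows "inference_model n (4 * k) (codebook k 1) (gaussian_design n (4 * k)) N (one_bit_obs z n (4 * k)) K"
  using assms unfolding noise_laws_def
  by (intro inference_model.intro)
    (auto simp: finite_codebook codebook_nonempty gaussian_design gaussian_noise no_noise one_bit_obs_measurable)

lemma one_bit_exact_recovery_fails:
  assumes k: "0 < k" and n: "0 < n" and K: "K \<in> procedures n (4 * k)" and N: "N \<in> noise_laws n"
    and z: "z \<in> {- 1, 1}" and small: "2 * 2 ^ n \<le> (2 ^ k :: nat)"
  shows "\<P>((\<beta>, X, e, b) in joint_law (4 * k) (codebook k 1) (gaussian_design n (4 * k))
    N (one_bit_obs z n (4 * k)) K. b \<noteq> \<beta>) \<ge> 1 / 2"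
proof -
  interpret inference_model n "4 * k" "codebook k 1" "gaussian_design n (4 * k)" N "one_bit_obs z n (4 * k)" K
    using k n K N by (rule one_bit_inference_model)
  show ?thesis
  proof (rule prob_ge_half_if_few_observations)
    show "AE (X, e) in gaussian_design n (4 * k) \<Otimes>\<^sub>M N. card ((\<lambda>\<beta>. one_bit_obs z n (4 * k) X \<beta> e) ` codebook k 1) \<le> 2 ^ n"
      by (intro AE_I2) (auto intro!: card_one_bit_obs_le[OF z])
  next
    fix \<beta> assume "\<beta> \<in> codebook k 1"
    from pred_eq_vec_space[OF codebook_in_PiE[OF this]]
    show "Measurable.pred (vec_space (4 * k)) (\<lambda>b. b \<noteq> \<beta>)"
      by (rule pred_intros_logic(2))
  next
    show "2 * 2 ^ n \<le> card (codebook k 1)"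
      using small card_codebook[of 1 k] k by linarith
  qed auto
qed

lemma one_bit_direction_recovery_fails:
  assumes k: "0 < k" and n: "0 < n" and K: "K \<in> procedures n (4 * k)" and N: "N \<in> noise_laws n"
    and z: "z \<in> {- 1, 1}" and small: "2 * 2 ^ n \<le> (2 ^ k :: nat)"
  shows "\<P>((\<beta>, X, e, b) in joint_law (4 * k) (codebook k 1) (gaussian_design n (4 * k))
    N (one_bit_obs z n (4 * k)) K.
      L2_set (\<lambda>i. b i / L2_set b {1..4 * k} - \<beta> i / L2_set \<beta> {1..4 * k}) {1..4 * k} \<ge> 1 / (2 * sqrt (3 * k))) \<ge> 1 / 2"
proof -
  interpret inference_model n "4 * k" "codebook k 1" "gaussian_design n (4 * k)" N "one_bit_obs z n (4 * k)" K
    using k n K N by (rule one_bit_inference_model)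
  \<comment> \<open>Half the gap between two normalized signals: they differ by
    \<open>1 / sqrt (3 * k)\<close> in some coordinate.\<close>
  let ?\<epsilon> = "1 / (2 * sqrt (3 * k))"
  let ?D = "\<lambda>\<beta> b. L2_set (\<lambda>i. b i / L2_set b {1..4 * k} - \<beta> i / L2_set \<beta> {1..4 * k}) {1..4 * k}"
  show ?thesis
  proof (rule prob_ge_half_if_few_observations)
    show "AE (X, e) in gaussian_design n (4 * k) \<Otimes>\<^sub>M N. card ((\<lambda>\<beta>. one_bit_obs z n (4 * k) X \<beta> e) ` codebook k 1) \<le> 2 ^ n"
      by (intro AE_I2) (auto intro!: card_one_bit_obs_le[OF z])
  next
    fix \<beta> :: "nat \<Rightarrow> real"
    have "?D \<beta> \<in> borel_measurable (vec_space (4 * k))"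
      by (intro L2_set_measurable borel_measurable_diff borel_measurable_divide vec_component_measurable
          borel_measurable_const) auto
    then show "Measurable.pred (vec_space (4 * k)) (\<lambda>b. ?\<epsilon> \<le> ?D \<beta> b)"
      by measurable
  next
    fix \<beta> \<beta>' b assume \<beta>: "\<beta> \<in> codebook k 1" "\<beta>' \<in> codebook k 1"
      and close: "\<not> ?\<epsilon> \<le> ?D \<beta> b" "\<not> ?\<epsilon> \<le> ?D \<beta>' b"
    show "\<beta> = \<beta>'"
    proof (rule ccontr)
      assume "\<beta> \<noteq> \<beta>'"
      then obtain j where j: "j \<in> {1..4 * k}" "\<bar>\<beta> j - \<beta>' j\<bar> = 1"
        using codebook_separated[OF \<beta>] by (metis (no_types, lifting) abs_one)
      have "\<bar>\<beta> j / L2_set \<beta> {1..4 * k} - \<beta>' j / L2_set \<beta>' {1..4 * k}\<bar> < 2 * ?\<epsilon>"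
        by (rule L2_set_close_imp_coordinate_close[OF _ j(1), where w = "\<lambda>i. b i / L2_set b {1..4 * k}"])
          (use close in \<open>simp_all add: L2_set_def power2_commute[of "b _ / _"] not_le\<close>)
      moreover have "\<bar>\<beta> j / L2_set \<beta> {1..4 * k} - \<beta>' j / L2_set \<beta>' {1..4 * k}\<bar> = 2 * ?\<epsilon>"
        unfolding L2_set_codebook[OF \<beta>(1) one_neq_zero] L2_set_codebook[OF \<beta>(2) one_neq_zero]
        using j(2) by (simp add: diff_divide_distrib[symmetric])
      ultimately show False by simp
    qed
  next
    show "2 * 2 ^ n \<le> card (codebook k 1)"
      using small card_codebook[of 1 k] k by linarith
  qed
qed

subsection \<open>Noisy observations\<close>

context inference_model
begin

text \<open>The continuous counterpart of counting observations: at the cost of \<open>c\<close>,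
  the laws of the observation under the various signals are replaced by the single law
  \<open>\<nu>\<close>, and for a common \<open>y\<close> the success probabilities sum to at most
  1.\<close>

lemma nn_integral_sum_estimate_le:
  assumes X: "X \<in> space P\<^sub>X" and \<nu>: "prob_space \<nu>" "sets \<nu> = sets (vec_space n)"
    and dominated: "\<And>\<beta> g. \<beta> \<in> B \<Longrightarrow> g \<in> borel_measurable (vec_space n) \<Longrightarrow>
      (\<integral>\<^sup>+e. g (obs X \<beta> e) \<partial>P\<^sub>e) \<le> c * (\<integral>\<^sup>+y. g y \<partial>\<nu>)"
    and D: "\<And>\<beta>. \<beta> \<in> B \<Longrightarrow> D \<beta> \<in> sets (vec_space d)" "disjoint_family_on D B"
  shows "(\<integral>\<^sup>+e. (\<Sum>\<beta>\<in>B. emeasure (K (X, obs X \<beta> e)) (D \<beta>)) \<partial>P\<^sub>e) \<le> c"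
proof -
  have X': "(\<lambda>y. (X, y)) \<in> M \<rightarrow>\<^sub>M P\<^sub>X \<Otimes>\<^sub>M M" for M :: "(nat \<Rightarrow> real) measure"
    using X by measurable
  have g: "(\<lambda>y. emeasure (K (X, y)) (D \<beta>)) \<in> borel_measurable (vec_space n)" if "\<beta> \<in> B" for \<beta>
    by (rule measurable_compose[OF X' measurable_emeasure_kernel[OF measurable_prob_algebraD[OF K_measurable] D(1)[OF that]]])
  have obs: "(\<lambda>e. obs X \<beta> e) \<in> P\<^sub>e \<rightarrow>\<^sub>M vec_space n" for \<beta>
    using measurable_compose[OF X' obs_measurable'[of \<beta>]] by simp
  have "(\<integral>\<^sup>+e. (\<Sum>\<beta>\<in>B. emeasure (K (X, obs X \<beta> e)) (D \<beta>)) \<partial>P\<^sub>e)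
      = (\<Sum>\<beta>\<in>B. \<integral>\<^sup>+e. emeasure (K (X, obs X \<beta> e)) (D \<beta>) \<partial>P\<^sub>e)"
    by (intro nn_integral_sum measurable_compose[OF obs g])
  also have "\<dots> \<le> (\<Sum>\<beta>\<in>B. c * (\<integral>\<^sup>+y. emeasure (K (X, y)) (D \<beta>) \<partial>\<nu>))"
    by (intro sum_mono dominated g)
  also have "\<dots> = c * (\<integral>\<^sup>+y. (\<Sum>\<beta>\<in>B. emeasure (K (X, y)) (D \<beta>)) \<partial>\<nu>)"
    using g by (subst nn_integral_sum) (auto simp: sum_distrib_left measurable_cong_sets[OF \<nu>(2) refl])
  also have "\<dots> \<le> c * (\<integral>\<^sup>+y. 1 \<partial>\<nu>)"
    using sets_eq_imp_space_eq[OF \<nu>(2)]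
    by (intro mult_left_mono nn_integral_mono sum_estimate_le X D) auto
  also have "\<dots> = c"
    using prob_space.emeasure_space_1[OF \<nu>(1)] by simp
  finally show ?thesis .
qed

end

text \<open>Each matrix entry is bounded by the Frobenius bound \<open>t\<close>. The crude factor
  \<open>d\<close> is affordable, because the domination factor may be polynomial in
  \<open>s\<close>.\<close>

lemma abs_mat_vec_le:
  assumes X: "(\<Sum>ij\<in>{1..n} \<times> {1..d}. (X ij)\<^sup>2) \<le> t\<^sup>2" "0 \<le> t"
    and \<beta>: "\<And>j. j \<in> {1..d} \<Longrightarrow> \<bar>\<beta> j\<bar> \<le> a" and i: "i \<in> {1..n}"
  shows "\<bar>mat_vec n d X \<beta> i\<bar> \<le> d * (t * a)"
proof -
  have "\<bar>X (i, j)\<bar> \<le> t" if "j \<in> {1..d}" for j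
  proof -
    have "(X (i, j))\<^sup>2 \<le> (\<Sum>ij\<in>{1..n} \<times> {1..d}. (X ij)\<^sup>2)"
      using i that by (intro member_le_sum) auto
    then show ?thesis
      using X abs_le_square_iff[of "X (i, j)" t] by simp
  qed
  then have "\<bar>X (i, j) * \<beta> j\<bar> \<le> t * a" if "j \<in> {1..d}" for j
    using that \<beta> X(2) unfolding abs_mult by (intro mult_mono) auto
  then have "(\<Sum>j\<in>{1..d}. \<bar>X (i, j) * \<beta> j\<bar>) \<le> (\<Sum>j\<in>{1..d}. t * a)"
    by (rule sum_mono)
  with i show ?thesis
    unfolding mat_vec_def by (simp add: order_trans[OF sum_abs])
qed

text \<open>
  The factor by which a single Gaussian of variance \<open>\<tau>\<^sup>2 = \<sigma>\<^sup>2 + q\<^sup>2\<close> dominates the noise shifted by at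
  most \<open>q = 32 d \<surd>d \<surd>n \<sigma>\<close>: this \<open>q\<close> bounds the entries of \<open>X \<beta>\<close> when the entries of \<open>\<beta>\<close> are at most
  \<open>8 \<surd>n \<sigma>\<close> and \<open>X\<close> has Frobenius norm at most \<open>4 \<surd>d\<close>.
\<close>

definition domination_factor :: "nat \<Rightarrow> nat \<Rightarrow> real" where
  "domination_factor n d = sqrt (1 + 1024 * n * real d ^ 3) * exp (1 / 2)"

text \<open>The decisive uniformity: \<open>\<tau>\<close> involves neither X nor
  \<open>\<beta>\<close>, so one Gaussian law dominates the observations from all signals.\<close>

lemma nn_integral_noisy_obs_le:
  assumes n: "0 < n" and \<sigma>: "0 < \<sigma>"
    and X: "(\<Sum>ij\<in>{1..n} \<times> {1..d}. (X ij)\<^sup>2) \<le> 16 * d"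
    and \<beta>: "\<And>j. j \<in> {1..d} \<Longrightarrow> \<bar>\<beta> j\<bar> \<le> 8 * sqrt n * \<sigma>"
    and g: "g \<in> borel_measurable (vec_space n)"
    and \<tau>: "\<tau> = sqrt (\<sigma>\<^sup>2 + (d * (4 * sqrt d * (8 * sqrt n * \<sigma>)))\<^sup>2)"
  shows "(\<integral>\<^sup>+e. g (noisy_obs n d X \<beta> e) \<partial>gaussian_noise n \<sigma>)
    \<le> ennreal (domination_factor n d ^ n) * (\<integral>\<^sup>+y. g y \<partial>gaussian_noise n \<tau>)"
proof -
  define q where "q = d * (4 * sqrt d * (8 * sqrt n * \<sigma>))"
  have \<tau>q: "\<tau> = sqrt (\<sigma>\<^sup>2 + q\<^sup>2)"
    unfolding \<tau> q_def ..
  have \<tau>0: "0 < \<tau>"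
    unfolding \<tau>q using \<sigma> by (simp add: add_pos_nonneg)
  have v: "\<bar>mat_vec n d X \<beta> i\<bar> \<le> q" if "i \<in> {1..n}" for i
    unfolding q_def using that X by (intro abs_mat_vec_le \<beta>) (auto simp: power_mult_distrib)
  \<comment> \<open>As \<open>q\<close> is proportional to \<sigma>, the ratio
    \<open>\<tau> / \<sigma>\<close> is free of \<sigma>.\<close>
  have "\<sigma>\<^sup>2 + q\<^sup>2 = \<sigma>\<^sup>2 * (1 + 1024 * n * real d ^ 3)"
    by (simp add: q_def power_mult_distrib power3_eq_cube power2_eq_square algebra_simps)
  then have L: "\<tau> / \<sigma> * exp (1 / 2) = domination_factor n d"
    using \<sigma> by (simp add: \<tau>q domination_factor_def real_sqrt_mult)
  have "(\<integral>\<^sup>+e. g (\<lambda>i\<in>{1..n}. mat_vec n d X \<beta> i + e i) \<partial>(\<Pi>\<^sub>M i\<in>{1..n}. normal_law \<sigma>))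
      \<le> ennreal (domination_factor n d) ^ card {1..n} * (\<integral>\<^sup>+y. g y \<partial>(\<Pi>\<^sub>M i\<in>{1..n}. normal_law \<tau>))"
  proof (rule nn_integral_PiM_translate_le)
    show "sigma_finite_measure (normal_law \<sigma>)" "sigma_finite_measure (normal_law \<tau>)"
      using \<sigma> \<tau>0 by (auto intro!: prob_space_imp_sigma_finite prob_space_normal_law)
  next
    fix i and g' :: "real \<Rightarrow> ennreal" assume "i \<in> {1..n}" "g' \<in> borel_measurable borel"
    then show "(\<integral>\<^sup>+x. g' (mat_vec n d X \<beta> i + x) \<partial>normal_law \<sigma>)
        \<le> ennreal (domination_factor n d) * (\<integral>\<^sup>+x. g' x \<partial>normal_law \<tau>)"
      unfolding L[symmetric] by (intro nn_integral_normal_law_translate_le[OF \<sigma> v \<tau>q])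
  qed (use g in \<open>auto simp: vec_space_def\<close>)
  then show ?thesis
    by (simp add: noisy_obs_def gaussian_noise_def iid_vec_def ennreal_power domination_factor_def)
qed

text \<open>The success probability is at most 1/16 for an atypical design, plus 1/16 for atypical
  noise, plus 1/2 from domination: 5/8 in total, within the allowed 9/10.\<close>

lemma noisy_recovery_fails:
  assumes k: "0 < k" and n: "0 < n" and \<sigma>: "0 < \<sigma>" and K: "K \<in> procedures n (4 * k)"
    and C: "0 < C" "C \<le> 1" and small: "2 * domination_factor n (4 * k) ^ n \<le> 2 ^ k"
  shows "\<P>((\<beta>, X, e, b) in joint_law (4 * k) (codebook k (8 * sqrt n * \<sigma>)) (gaussian_design n (4 * k))
      (gaussian_noise n \<sigma>) (noisy_obs n (4 * k)) K.
    L2_set (\<lambda>i. \<beta> i - b i) {1..4 * k} \<ge> C * L2_set e {1..n}) \<ge> 1 / 10"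
proof -
  define a where "a = 8 * sqrt n * \<sigma>"
  define d where "d = 4 * k"
  define B where "B = codebook k a"
  define P\<^sub>X where "P\<^sub>X = gaussian_design n d"
  define P\<^sub>e where "P\<^sub>e = gaussian_noise n \<sigma>"
  define L where "L = domination_factor n d"
  have a: "0 < a"
    using n \<sigma> by (simp add: a_def)
  interpret inference_model n d B P\<^sub>X P\<^sub>e "noisy_obs n d" K
    using k n K a \<sigma> unfolding B_def P\<^sub>X_def P\<^sub>e_def d_def by (intro inference_model.intro)
      (simp_all add: finite_codebook codebook_nonempty gaussian_design gaussian_noise noisy_obs_measurable)
  interpret P\<^sub>e: prob_space P\<^sub>e by (rule prob_noise)
  interpret P\<^sub>X: prob_space P\<^sub>X by (rule prob_design)
  \<comment> \<open>Both thresholds are 16 times the mean: the squared Frobenius norm has mean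
    \<open>d\<close>, the squared noise norm has mean \<open>n * \<sigma>\<^sup>2\<close>.\<close>
  define bad_X where "bad_X = {X \<in> space P\<^sub>X. 16 * real d < (\<Sum>ij\<in>{1..n} \<times> {1..d}. (X ij)\<^sup>2)}"
  define bad_e where "bad_e = {e \<in> space P\<^sub>e. 16 * real n * \<sigma>\<^sup>2 < (\<Sum>i\<in>{1..n}. (e i)\<^sup>2)}"
  have bad_X: "emeasure P\<^sub>X bad_X \<le> ennreal (1 / 16)"
    using emeasure_sum_squares_normal_le[of "{1..n} \<times> {1..d}" "1 / sqrt n" 16] n
    by (simp add: bad_X_def P\<^sub>X_def gaussian_design_def iid_mat_def power_divide)
  have bad_e: "emeasure P\<^sub>e bad_e \<le> ennreal (1 / 16)"
    using emeasure_sum_squares_normal_le[of "{1..n}" \<sigma> 16] \<sigma>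
    by (simp add: bad_e_def P\<^sub>e_def gaussian_noise_def iid_vec_def)
  have bad_X_sets [measurable]: "bad_X \<in> sets P\<^sub>X"
    unfolding bad_X_def P\<^sub>X_def gaussian_design_def iid_mat_def by measurable
  have bad_e_sets [measurable]: "bad_e \<in> sets P\<^sub>e"
    unfolding bad_e_def P\<^sub>e_def gaussian_noise_def iid_vec_def by measurable
  \<comment> \<open>The radius \<open>a / 2\<close> equals the bound
    \<open>4 * sqrt n * \<sigma>\<close> on typical noise and is half the coordinate gap between two
    signals.\<close>
  define D where "D \<beta> = {b \<in> space (vec_space d). L2_set (\<lambda>i. \<beta> i - b i) {1..d} < a / 2}" for \<beta>
  have dist_measurable: "(\<lambda>b. L2_set (\<lambda>i. \<beta> i - b i) {1..d}) \<in> borel_measurable (vec_space d)" for \<beta>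
    by (intro L2_set_measurable borel_measurable_diff vec_component_measurable borel_measurable_const)
  have D: "D \<beta> \<in> sets (vec_space d)" for \<beta>
    unfolding D_def using dist_measurable by measurable
  have disj_D: "disjoint_family_on D B"
  proof (rule ccontr)
    assume "\<not> disjoint_family_on D B"
    then obtain \<beta> \<beta>' b where \<beta>: "\<beta> \<in> codebook k a" "\<beta>' \<in> codebook k a" "\<beta> \<noteq> \<beta>'" and b: "b \<in> D \<beta>" "b \<in> D \<beta>'"
      unfolding disjoint_family_on_def B_def by blast
    obtain j where j: "j \<in> {1..d}" "\<bar>\<beta> j - \<beta>' j\<bar> = \<bar>a\<bar>"
      using codebook_separated[OF \<beta>] unfolding d_def by metis
    have "\<bar>\<beta> j - \<beta>' j\<bar> < 2 * (a / 2)"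
      by (rule L2_set_close_imp_coordinate_close[OF _ j(1), where w = b]) (use b in \<open>simp_all add: D_def\<close>)
    with j(2) show False by simp
  qed
  have card_B: "0 < card B" "2 ^ k \<le> card B"
    using card_codebook[of a k] a k unfolding B_def by (auto intro: order_less_le_trans[of 0 "2 ^ k"])
  define S where "S X e = (\<Sum>\<beta>\<in>B. emeasure (K (X, noisy_obs n d X \<beta> e)) (D \<beta>))" for X e
  define h where "h X e = indicator bad_X X + (indicator bad_e e + indicator (space P\<^sub>X - bad_X) X * (ennreal (1 / card B) * S X e))" for X e
  have S_measurable [measurable]: "(\<lambda>(X, e). S X e) \<in> borel_measurable (P\<^sub>X \<Otimes>\<^sub>M P\<^sub>e)"
    unfolding S_def case_prod_beta
    using measurable_emeasure_kernel[OF measurable_prob_algebraD[OF estimate_measurable] D]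
    by (intro borel_measurable_sum) (simp add: case_prod_beta)
  have h_measurable: "(\<lambda>(X, e). h X e) \<in> borel_measurable (P\<^sub>X \<Otimes>\<^sub>M P\<^sub>e)"
    unfolding h_def by measurable
  have pointwise: "ennreal (1 / card B) * (\<Sum>\<beta>\<in>B. emeasure (K (X, noisy_obs n d X \<beta> e))
      {b \<in> space (vec_space d). \<not> C * L2_set e {1..n} \<le> L2_set (\<lambda>i. \<beta> i - b i) {1..d}}) \<le> h X e"
    (is "ennreal (1 / card B) * (\<Sum>\<beta>\<in>B. ?p \<beta>) \<le> _") if X: "X \<in> space P\<^sub>X" and e: "e \<in> space P\<^sub>e" for X e
  proof (cases "X \<in> bad_X \<or> e \<in> bad_e")
    case True
    have "ennreal (1 / card B) * (\<Sum>\<beta>\<in>B. ?p \<beta>) \<le> ennreal (1 / card B) * (\<Sum>\<beta>\<in>B. 1)"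
      using X e by (intro mult_left_mono sum_mono prob_space.emeasure_le_1 estimate_prob_space) auto
    also have "\<dots> = 1"
      using card_B by (simp add: ennreal_of_nat_eq_real_of_nat ennreal_mult[symmetric])
    also have "\<dots> \<le> h X e"
      using True X by (auto simp: h_def add_increasing2)
    finally show ?thesis .
  next
    case False
    have "(\<Sum>i\<in>{1..n}. (e i)\<^sup>2) \<le> (4 * sqrt n * \<sigma>)\<^sup>2"
      using False e by (simp add: bad_e_def power_mult_distrib)
    then have "L2_set e {1..n} \<le> 4 * sqrt n * \<sigma>"
      unfolding L2_set_def using \<sigma> by (intro real_le_lsqrt) auto
    then have "L2_set e {1..n} \<le> a / 2"
      by (simp add: a_def ac_simps)
    then have "C * L2_set e {1..n} \<le> a / 2"
      using C mult_right_mono[of C 1 "L2_set e {1..n}"] by (simp add: L2_set_nonneg)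
    \<comment> \<open>For typical noise and \<open>C \<le> 1\<close>, an error below
      \<open>C * L2_set e {1..n}\<close> places the estimate in \<open>D \<beta>\<close>.\<close>
    then have "(\<Sum>\<beta>\<in>B. ?p \<beta>) \<le> S X e"
      unfolding S_def using D estimate_prob_space(2)[OF X e]
      by (intro sum_mono emeasure_mono) (auto simp: D_def)
    then show ?thesis
      using False X by (simp add: h_def mult_left_mono)
  qed
  have inner: "(\<integral>\<^sup>+e. h X e \<partial>P\<^sub>e) \<le> indicator bad_X X + ennreal (9 / 16)" if X: "X \<in> space P\<^sub>X" for X
  proof -
    have S_X: "S X \<in> borel_measurable P\<^sub>e"
      using measurable_compose[OF measurable_Pair1'[OF X] S_measurable] by simp
    \<comment> \<open>For a typical design the success probabilities sum to at most
      \<open>L ^ n\<close>, which is at most half of \<open>card B\<close>.\<close>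
    have "indicator (space P\<^sub>X - bad_X) X * (ennreal (1 / card B) * (\<integral>\<^sup>+e. S X e \<partial>P\<^sub>e)) \<le> ennreal (1 / 2)"
    proof (cases "X \<in> bad_X")
      case False
      define \<tau> where "\<tau> = sqrt (\<sigma>\<^sup>2 + (d * (4 * sqrt d * (8 * sqrt n * \<sigma>)))\<^sup>2)"
      have \<tau>: "0 < \<tau>"
        unfolding \<tau>_def using \<sigma> by (simp add: add_pos_nonneg)
      have "(\<integral>\<^sup>+e. S X e \<partial>P\<^sub>e) \<le> ennreal (L ^ n)"
        unfolding S_def
      proof (rule nn_integral_sum_estimate_le[OF X gaussian_noise[OF \<tau>] _ D disj_D])
        fix \<beta> and g :: "(nat \<Rightarrow> real) \<Rightarrow> ennreal" assume "\<beta> \<in> B" and g: "g \<in> borel_measurable (vec_space n)"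
        then have "\<bar>\<beta> j\<bar> \<le> 8 * sqrt n * \<sigma>" if "j \<in> {1..d}" for j
          using codebook_values[of \<beta> k a j] that a unfolding B_def d_def a_def[symmetric] by auto
        with False X g show "(\<integral>\<^sup>+e. g (noisy_obs n d X \<beta> e) \<partial>P\<^sub>e)
            \<le> ennreal (L ^ n) * (\<integral>\<^sup>+y. g y \<partial>gaussian_noise n \<tau>)"
          unfolding P\<^sub>e_def L_def by (intro nn_integral_noisy_obs_le n \<sigma> \<tau>_def) (auto simp: bad_X_def)
      qed
      then have "ennreal (1 / card B) * (\<integral>\<^sup>+e. S X e \<partial>P\<^sub>e) \<le> ennreal (1 / card B) * ennreal (L ^ n)"
        by (rule mult_left_mono) simp
      also have "\<dots> = ennreal (1 / card B * L ^ n)"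
        by (rule ennreal_mult[symmetric]) (auto simp: L_def domination_factor_def)
      also have "\<dots> \<le> ennreal (1 / 2)"
      proof (rule ennreal_leI)
        have "2 * L ^ n \<le> 2 ^ k"
          using small by (simp add: L_def d_def)
        also have "\<dots> \<le> card B"
          using card_B(2) by (metis of_nat_le_iff of_nat_numeral of_nat_power)
        finally show "1 / card B * L ^ n \<le> 1 / 2"
          using card_B(1) by (simp add: field_simps)
      qed
      finally show ?thesis
        using False X by simp
    qed simp
    moreover have "(\<integral>\<^sup>+e. h X e \<partial>P\<^sub>e) = indicator bad_X X + (emeasure P\<^sub>e bad_e +
        indicator (space P\<^sub>X - bad_X) X * (ennreal (1 / card B) * (\<integral>\<^sup>+e. S X e \<partial>P\<^sub>e)))"
      unfolding h_def using S_X by (simp add: nn_integral_add nn_integral_cmult P\<^sub>e.emeasure_space_1)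
    ultimately have "(\<integral>\<^sup>+e. h X e \<partial>P\<^sub>e) \<le> indicator bad_X X + (ennreal (1 / 16) + ennreal (1 / 2))"
      using bad_e by (simp only: add_mono order_refl)
    also have "ennreal (1 / 16) + ennreal (1 / 2) = ennreal (9 / 16)"
      by (subst ennreal_plus[symmetric]) auto
    finally show ?thesis .
  qed
  have "(\<integral>\<^sup>+(X, e). h X e \<partial>(P\<^sub>X \<Otimes>\<^sub>M P\<^sub>e)) = (\<integral>\<^sup>+X. \<integral>\<^sup>+e. h X e \<partial>P\<^sub>e \<partial>P\<^sub>X)"
    using P\<^sub>e.nn_integral_fst[OF h_measurable] by simp
  also have "\<dots> \<le> (\<integral>\<^sup>+X. indicator bad_X X + ennreal (9 / 16) \<partial>P\<^sub>X)"
    by (intro nn_integral_mono inner)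
  also have "\<dots> = emeasure P\<^sub>X bad_X + ennreal (9 / 16)"
    by (simp add: nn_integral_add P\<^sub>X.emeasure_space_1)
  also have "\<dots> \<le> ennreal (1 / 16) + ennreal (9 / 16)"
    by (intro add_mono bad_X order_refl)
  also have "\<dots> \<le> ennreal (9 / 10)"
    by (subst ennreal_plus[symmetric]) (auto intro!: ennreal_leI)
  finally have "(\<integral>\<^sup>+(X, e). h X e \<partial>(P\<^sub>X \<Otimes>\<^sub>M P\<^sub>e)) \<le> ennreal (9 / 10)" .
  moreover have "(\<integral>\<^sup>+(X, e). ennreal (1 / card B) * (\<Sum>\<beta>\<in>B. emeasure (K (X, noisy_obs n d X \<beta> e))
      {b \<in> space (vec_space d). \<not> C * L2_set e {1..n} \<le> L2_set (\<lambda>i. \<beta> i - b i) {1..d}}) \<partial>(P\<^sub>X \<Otimes>\<^sub>M P\<^sub>e))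
      \<le> (\<integral>\<^sup>+(X, e). h X e \<partial>(P\<^sub>X \<Otimes>\<^sub>M P\<^sub>e))"
    using pointwise by (intro nn_integral_mono) (auto simp: space_pair_measure)
  ultimately have "1 - 9 / 10 \<le> \<P>((\<beta>, X, e, b) in \<J>. C * L2_set e {1..n} \<le> L2_set (\<lambda>i. \<beta> i - b i) {1..d})"
  proof (intro prob_joint_law_ge)
    fix \<beta> :: "nat \<Rightarrow> real"
    have [measurable]: "(\<lambda>e. L2_set e {1..n}) \<in> borel_measurable (vec_space n)"
      by (intro L2_set_measurable vec_component_measurable)
    note [measurable] = dist_measurable[of \<beta>]
    show "Measurable.pred (mat_space n d \<Otimes>\<^sub>M vec_space n \<Otimes>\<^sub>M vec_space d)
        (\<lambda>(X, e, b). C * L2_set e {1..n} \<le> L2_set (\<lambda>i. \<beta> i - b i) {1..d})"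
      unfolding case_prod_beta by measurable
  qed auto
  then show ?thesis
    unfolding B_def P\<^sub>X_def P\<^sub>e_def a_def d_def by simp
qed

section \<open>Numerical conditions relating n and k\<close>

lemma domination_factor_le:
  assumes k: "29 \<le> k" and n: "n \<le> 3 * k"
  shows "domination_factor n (4 * k) \<le> real (3 * k) ^ 3"
proof -
  \<comment> \<open>The estimate is carried out for squares; inserting \<open>n \<le> 3 * k\<close>
    produces the constant 1024 * 3 * 64 = 196608.\<close>
  have "1 + 1024 * real n * real (4 * k) ^ 3 \<le> 1 + 1024 * real (3 * k) * real (4 * k) ^ 3"
    using n by (intro add_left_mono mult_right_mono mult_left_mono) auto
  also have "\<dots> = 1 + 196608 * real k ^ 4"
    by (simp add: power_mult_distrib power3_eq_cube power4_eq_xxxx)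
  also have "\<dots> \<le> 196609 * real k ^ 4"
    using k by simp
  finally have "(1 + 1024 * real n * real (4 * k) ^ 3) * exp 1 \<le> (196609 * real k ^ 4) * 3"
    using exp_le by (intro mult_mono) auto
  \<comment> \<open>The threshold 29 comes from here: it is the least \<open>k\<close> with
    \<open>729 * k * k\<close> at least 196609 * 3, where 3 bounds \<open>exp 1\<close>.\<close>
  also have "\<dots> \<le> 729 * (real k)\<^sup>2 * real k ^ 4"
  proof -
    have "29 * 29 \<le> real k * real k"
      using k by (intro mult_mono) auto
    then have "196609 * 3 \<le> 729 * (real k)\<^sup>2"
      by (simp add: power2_eq_square)
    from mult_right_mono[OF this, of "real k ^ 4"] show ?thesis
      by simp
  qed
  also have "\<dots> = (real (3 * k) ^ 3)\<^sup>2"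
    by (simp add: power_mult_distrib flip: power_mult power_add)
  finally have "sqrt ((1 + 1024 * real n * real (4 * k) ^ 3) * exp 1) \<le> real (3 * k) ^ 3"
    by (intro real_le_lsqrt) auto
  moreover have "sqrt (exp 1) = exp (1 / 2 :: real)"
    by (rule real_sqrt_unique) (simp_all add: power2_eq_square flip: exp_add)
  ultimately show ?thesis
    by (simp add: domination_factor_def real_sqrt_mult)
qed

lemma small_sample_noisy:
  assumes k: "29 \<le> k" and small: "2 * real (3 * k) ^ (3 * n) \<le> 2 ^ k"
  shows "2 * domination_factor n (4 * k) ^ n \<le> 2 ^ k"
proof -
  \<comment> \<open>The smallness hypothesis itself forces \<open>3 * n \<le> k\<close>, which
    supplies the bound \<open>n \<le> 3 * k\<close> for \<open>domination_factor_le\<close>.\<close>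
  have "(2 :: real) ^ (3 * n) \<le> real (3 * k) ^ (3 * n)"
    using k by (intro power_mono) auto
  with small have "(2 :: real) ^ (3 * n) \<le> 2 ^ k"
    using zero_le_power[of "real (3 * k)" "3 * n"] by linarith
  then have "n \<le> 3 * k" by simp
  then have "domination_factor n (4 * k) ^ n \<le> (real (3 * k) ^ 3) ^ n"
    by (intro power_mono domination_factor_le k) (simp_all add: domination_factor_def)
  then show ?thesis
    using small by (simp add: power_mult)
qed

lemma small_sample_noiseless:
  assumes k: "0 < k" and small: "2 * real (3 * k) ^ (3 * n) \<le> 2 ^ k"
  shows "2 * (8 * k + 1) ^ n \<le> (2 ^ k :: nat)"
proof -
  have "8 * k + 1 \<le> 27 * (k * (k * k))"
    using k by (cases k) (auto simp: algebra_simps)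
  then have "8 * k + 1 \<le> (3 * k) ^ 3"
    by (simp add: power3_eq_cube)
  then have "2 * (8 * k + 1) ^ n \<le> 2 * (3 * k) ^ (3 * n)"
    by (simp only: power_mult) (intro mult_left_mono power_mono, auto)
  also have "\<dots> \<le> 2 ^ k"
    using small by (simp only: of_nat_le_iff[where 'a = real, symmetric] of_nat_mult of_nat_power of_nat_numeral)
  finally show ?thesis .
qed

section \<open>Combination of the four settings along one sequence of combs\<close>

theorem corollary1:
  shows "\<exists>(d :: nat \<Rightarrow> nat) (r :: nat \<Rightarrow> nat) (\<pi> :: nat \<Rightarrow> nat \<Rightarrow> nat) (s :: nat \<Rightarrow> nat).
    (\<forall>m. rooted_binary_tree (d m) (r m) (\<pi> m) \<and> 1 \<le> s m \<and> s m \<le> d m) \<and>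
    filterlim s at_top sequentially \<and>
    (\<exists>C\<^sub>0 > 0. \<forall>n :: nat \<Rightarrow> nat.
       (\<forall>m. 0 < n m) \<and> (\<lambda>m. real (n m)) \<in> o(\<lambda>m. real (s m) / ln (real (s m))) \<longrightarrow>
       (\<forall>\<^sub>F m in sequentially. \<forall>\<sigma> > 0.
          \<exists>B. signal_set (d m) (tree_model (d m) (r m) (\<pi> m) (s m)) B \<and>
            (\<forall>K \<in> procedures (n m) (d m). \<forall>C. 0 < C \<and> C \<le> C\<^sub>0 \<longrightarrow>
               \<P>((\<beta>, X, e, b) in joint_law (d m) B (gaussian_design (n m) (d m))
                     (gaussian_noise (n m) \<sigma>) (noisy_obs (n m) (d m)) K.
                   L2_set (\<lambda>i. \<beta> i - b i) {1..d m} \<ge> C * L2_set e {1..n m}) \<ge> 1 / 10))) \<and>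
    (\<forall>n :: nat \<Rightarrow> nat.
       (\<forall>m. 0 < n m) \<and> (\<lambda>m. real (n m)) \<in> o(\<lambda>m. real (s m) / ln (real (s m))) \<longrightarrow>
       (\<forall>\<^sub>F m in sequentially.
          \<exists>B. signal_set (d m) (tree_model (d m) (r m) (\<pi> m) (s m)) B \<and>
            (\<forall>K \<in> procedures (n m) (d m).
               \<P>((\<beta>, X, e, b) in joint_law (d m) B (sign_design (n m) (d m))
                     (no_noise (n m)) (noiseless_obs (n m) (d m)) K.
                   \<beta> \<noteq> b) \<ge> 1 / 2))) \<and>
    (\<exists>\<epsilon> :: nat \<Rightarrow> real. (\<forall>m. 0 < \<epsilon> m) \<and>
       (\<forall>n :: nat \<Rightarrow> nat.
          (\<forall>m. 0 < n m) \<and> (\<lambda>m. real (n m)) \<in> o(\<lambda>m. real (s m)) \<longrightarrow>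
          (\<forall>\<^sub>F m in sequentially.
             \<forall>z \<in> {- 1, 1}. \<forall>N \<in> insert (no_noise (n m)) {gaussian_noise (n m) \<sigma> |\<sigma>. 0 < \<sigma>}.
             \<exists>B. signal_set (d m) (tree_model (d m) (r m) (\<pi> m) (s m)) B \<and>
               (\<forall>K \<in> nonzero_procedures (n m) (d m).
                  \<P>((\<beta>, X, e, b) in joint_law (d m) B (gaussian_design (n m) (d m))
                        N (one_bit_obs z (n m) (d m)) K.
                      L2_set (\<lambda>i. b i / L2_set b {1..d m} - \<beta> i / L2_set \<beta> {1..d m}) {1..d m}
                        \<ge> \<epsilon> m) \<ge> 1 / 2)))) \<and>
    (\<forall>n :: nat \<Rightarrow> nat.
       (\<forall>m. 0 < n m) \<and> (\<lambda>m. real (n m)) \<in> o(\<lambda>m. real (s m)) \<longrightarrow>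
       (\<forall>\<^sub>F m in sequentially.
          \<forall>z \<in> {- 1, 1}. \<forall>N \<in> insert (no_noise (n m)) {gaussian_noise (n m) \<sigma> |\<sigma>. 0 < \<sigma>}.
          \<exists>B. signal_set (d m) (tree_model (d m) (r m) (\<pi> m) (s m)) B \<and>
            (\<forall>K \<in> procedures (n m) (d m).
               \<P>((\<beta>, X, e, b) in joint_law (d m) B (gaussian_design (n m) (d m))
                     N (one_bit_obs z (n m) (d m)) K.
                   b \<noteq> \<beta>) \<ge> 1 / 2)))"
\<comment> \<open>The comb with \<open>k = Suc m\<close>, so that \<open>k\<close> is positive for
  every \<open>m\<close>.\<close>
proof (rule exI[of _ "\<lambda>m. 4 * Suc m"], rule exI[of _ "\<lambda>m. 1"], rule exI[of _ "\<lambda>m. comb_parent (Suc m)"],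
    rule exI[of _ "\<lambda>m. 3 * Suc m"], intro conjI allI impI; (elim conjE)?)
  fix m
  show "rooted_binary_tree (4 * Suc m) 1 (comb_parent (Suc m))"
    by (rule rooted_binary_tree_comb) simp
  show "1 \<le> 3 * Suc m" "3 * Suc m \<le> 4 * Suc m"
    by simp_all
next
  show "filterlim (\<lambda>m. 3 * Suc m) at_top sequentially"
    by (rule filterlim_at_top_mono[OF filterlim_ident]) auto
next
  show "\<exists>C\<^sub>0 > 0. \<forall>n :: nat \<Rightarrow> nat.
       (\<forall>m. 0 < n m) \<and> (\<lambda>m. real (n m)) \<in> o(\<lambda>m. real (3 * Suc m) / ln (real (3 * Suc m))) \<longrightarrow>
       (\<forall>\<^sub>F m in sequentially. \<forall>\<sigma> > 0.
          \<exists>B. signal_set (4 * Suc m) (tree_model (4 * Suc m) 1 (comb_parent (Suc m)) (3 * Suc m)) B \<and>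
            (\<forall>K \<in> procedures (n m) (4 * Suc m). \<forall>C. 0 < C \<and> C \<le> C\<^sub>0 \<longrightarrow>
               \<P>((\<beta>, X, e, b) in joint_law (4 * Suc m) B (gaussian_design (n m) (4 * Suc m))
                     (gaussian_noise (n m) \<sigma>) (noisy_obs (n m) (4 * Suc m)) K.
                   L2_set (\<lambda>i. \<beta> i - b i) {1..4 * Suc m} \<ge> C * L2_set e {1..n m}) \<ge> 1 / 10))"
  \<comment> \<open>The choice \<open>C\<^sub>0 = 1\<close> matches the signal amplitude, which is
    twice the bound on typical noise.\<close>
  proof (intro exI[of _ 1] conjI allI impI; (elim conjE)?)
    fix n :: "nat \<Rightarrow> nat"
    assume n: "\<forall>m. 0 < n m"
      and "(\<lambda>m. real (n m)) \<in> o(\<lambda>m. real (3 * Suc m) / ln (real (3 * Suc m)))"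
    from eventually_sample_size_small_log[OF this(2)] eventually_ge_at_top[of 29]
    show "\<forall>\<^sub>F m in sequentially. \<forall>\<sigma> > 0.
          \<exists>B. signal_set (4 * Suc m) (tree_model (4 * Suc m) 1 (comb_parent (Suc m)) (3 * Suc m)) B \<and>
            (\<forall>K \<in> procedures (n m) (4 * Suc m). \<forall>C. 0 < C \<and> C \<le> 1 \<longrightarrow>
               \<P>((\<beta>, X, e, b) in joint_law (4 * Suc m) B (gaussian_design (n m) (4 * Suc m))
                     (gaussian_noise (n m) \<sigma>) (noisy_obs (n m) (4 * Suc m)) K.
                   L2_set (\<lambda>i. \<beta> i - b i) {1..4 * Suc m} \<ge> C * L2_set e {1..n m}) \<ge> 1 / 10)"
    proof eventually_elim
      case (elim m)
      have "2 * domination_factor (n m) (4 * Suc m) ^ n m \<le> 2 ^ Suc m"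
        using elim by (intro small_sample_noisy) simp_all
      with n show ?case
      proof (intro allI impI, goal_cases)
        case (1 \<sigma>)
        \<comment> \<open>The amplitude scales with \<sigma> and with the square root of
          \<open>n m\<close>; this is why the signals are chosen after both.\<close>
        then show ?case
          by (intro exI[of _ "codebook (Suc m) (8 * sqrt (n m) * \<sigma>)"] conjI signal_set_codebook ballI allI impI
              noisy_recovery_fails; simp)
      qed
    qed
  qed simp
next
  fix n :: "nat \<Rightarrow> nat"
  assume "\<forall>m. 0 < n m" "(\<lambda>m. real (n m)) \<in> o(\<lambda>m. real (3 * Suc m) / ln (real (3 * Suc m)))"
  from eventually_sample_size_small_log[OF this(2)]
  show "\<forall>\<^sub>F m in sequentially.
          \<exists>B. signal_set (4 * Suc m) (tree_model (4 * Suc m) 1 (comb_parent (Suc m)) (3 * Suc m)) B \<and>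
            (\<forall>K \<in> procedures (n m) (4 * Suc m).
               \<P>((\<beta>, X, e, b) in joint_law (4 * Suc m) B (sign_design (n m) (4 * Suc m))
                     (no_noise (n m)) (noiseless_obs (n m) (4 * Suc m)) K.
                   \<beta> \<noteq> b) \<ge> 1 / 2)"
  proof eventually_elim
    case (elim m)
    have "0 < Suc m" by simp
    from small_sample_noiseless[OF this elim] show ?case
      by (intro exI[of _ "codebook (Suc m) 1"] conjI ballI signal_set_codebook noiseless_recovery_fails) simp_all
  qed
next
  show "\<exists>\<epsilon> :: nat \<Rightarrow> real. (\<forall>m. 0 < \<epsilon> m) \<and>
       (\<forall>n :: nat \<Rightarrow> nat.
          (\<forall>m. 0 < n m) \<and> (\<lambda>m. real (n m)) \<in> o(\<lambda>m. real (3 * Suc m)) \<longrightarrow>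
          (\<forall>\<^sub>F m in sequentially.
             \<forall>z \<in> {- 1, 1}. \<forall>N \<in> insert (no_noise (n m)) {gaussian_noise (n m) \<sigma> |\<sigma>. 0 < \<sigma>}.
             \<exists>B. signal_set (4 * Suc m) (tree_model (4 * Suc m) 1 (comb_parent (Suc m)) (3 * Suc m)) B \<and>
               (\<forall>K \<in> nonzero_procedures (n m) (4 * Suc m).
                  \<P>((\<beta>, X, e, b) in joint_law (4 * Suc m) B (gaussian_design (n m) (4 * Suc m))
                        N (one_bit_obs z (n m) (4 * Suc m)) K.
                      L2_set (\<lambda>i. b i / L2_set b {1..4 * Suc m} - \<beta> i / L2_set \<beta> {1..4 * Suc m}) {1..4 * Suc m}
                        \<ge> \<epsilon> m) \<ge> 1 / 2)))"
  \<comment> \<open>This \<epsilon> depends on \<open>m\<close> through the sparsity alone, hence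
    not on the sample sizes, the noise or the procedure.\<close>
  proof (intro exI[of _ "\<lambda>m. 1 / (2 * sqrt (3 * Suc m))"] conjI allI impI; (elim conjE)?)
    fix n :: "nat \<Rightarrow> nat"
    assume n: "\<forall>m. 0 < n m" and "(\<lambda>m. real (n m)) \<in> o(\<lambda>m. real (3 * Suc m))"
    from eventually_sample_size_small[OF this(2)]
    show "\<forall>\<^sub>F m in sequentially.
             \<forall>z \<in> {- 1, 1}. \<forall>N \<in> insert (no_noise (n m)) {gaussian_noise (n m) \<sigma> |\<sigma>. 0 < \<sigma>}.
             \<exists>B. signal_set (4 * Suc m) (tree_model (4 * Suc m) 1 (comb_parent (Suc m)) (3 * Suc m)) B \<and>
               (\<forall>K \<in> nonzero_procedures (n m) (4 * Suc m).
                  \<P>((\<beta>, X, e, b) in joint_law (4 * Suc m) B (gaussian_design (n m) (4 * Suc m))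
                        N (one_bit_obs z (n m) (4 * Suc m)) K.
                      L2_set (\<lambda>i. b i / L2_set b {1..4 * Suc m} - \<beta> i / L2_set \<beta> {1..4 * Suc m}) {1..4 * Suc m}
                        \<ge> 1 / (2 * sqrt (3 * Suc m))) \<ge> 1 / 2)"
      unfolding noise_laws_def[symmetric]
    proof eventually_elim
      case (elim m)
      with n show ?case
        by (intro ballI exI[of _ "codebook (Suc m) 1"] conjI signal_set_codebook one_bit_direction_recovery_fails)
          (simp_all add: nonzero_procedures_def)
    qed
  qed simp
next
  fix n :: "nat \<Rightarrow> nat"
  assume n: "\<forall>m. 0 < n m" and "(\<lambda>m. real (n m)) \<in> o(\<lambda>m. real (3 * Suc m))"
  from eventually_sample_size_small[OF this(2)]
  show "\<forall>\<^sub>F m in sequentially.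
          \<forall>z \<in> {- 1, 1}. \<forall>N \<in> insert (no_noise (n m)) {gaussian_noise (n m) \<sigma> |\<sigma>. 0 < \<sigma>}.
          \<exists>B. signal_set (4 * Suc m) (tree_model (4 * Suc m) 1 (comb_parent (Suc m)) (3 * Suc m)) B \<and>
            (\<forall>K \<in> procedures (n m) (4 * Suc m).
               \<P>((\<beta>, X, e, b) in joint_law (4 * Suc m) B (gaussian_design (n m) (4 * Suc m))
                     N (one_bit_obs z (n m) (4 * Suc m)) K.
                   b \<noteq> \<beta>) \<ge> 1 / 2)"
    unfolding noise_laws_def[symmetric]
  proof eventually_elim
    case (elim m)
    with n show ?case
      by (intro ballI exI[of _ "codebook (Suc m) 1"] conjI signal_set_codebook one_bit_exact_recovery_fails) simp_all
  qed
qed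

end
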